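(* Let $n\ge 1$ and $c_1<c_2<\cdots<c_n$ be real numbers. For $(x,y,z)\in\mathbb{R}^3$ put $\rho^2=x^2+y^2$, $r_j=\sqrt{x^2+y^2+(z-c_j)^2}$ and $V=\frac12\sum_{j=1}^n\frac1{r_j}$. On $U\times S^1$, where $U=\mathbb{R}^3\setminus\{(0,0,z): z\ge c_1\}$ and $e^{\sqrt{-1}\varphi}\in S^1$, let $$\alpha=-\frac12\sum_{j=1}^n\frac{x\,dy-y\,dx}{r_j(r_j-(z-c_j))},$$ $$g=\frac1V(d\varphi+\alpha)^2+V(dx^2+dy^2+dz^2),\qquad \omega=(d\varphi+\alpha)\wedge dz+V\,dx\wedge dy .$$ On the part where $\rho>0$, take the local coordinates $$\theta_1=\varphi,\quad \mu_1=-z,\quad \theta_2=\arctan\frac yx,\quad \mu_2=\frac12\sum_{j=1}^n(r_j+z-c_j).$$ Then the symplectic form is $$\omega=d\mu_1\wedge d\theta_1+d\mu_2\wedge d\theta_2,$$ and the Gibbons-Hawking metric is $$\begin{aligned} g&=\frac1V d\theta_1^2-\frac1V\sum_{j=1}^n\frac{\rho^2}{r_j(r_j-(z-c_j))}\,d\theta_1 d\theta_2\\ &\quad+\Bigl[V\rho^2+\frac1{4V}\Bigl(\sum_{j=1}^n\frac{\rho^2}{r_j(r_j-(z-c_j))}\Bigr)^2\Bigr]d\theta_2^2\\ &\quad+\Bigl[V+\frac{\rho^2}{4V}\Bigl(\sum_{j=1}^n\frac1{r_j(r_j-(z-c_j))}\Bigr)^2\Bigr]d\mu_1^2\\ &\quad+\frac1V\sum_{j=1}^n\frac1{r_j(r_j-(z-c_j))}\,d\mu_1d\mu_2+\frac1{V\rho^2}d\mu_2^2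 .\end{aligned}$$ Moreover, for some constants $C_1,C_2$, the complex potential and the Kähler potential are given respectively by $$\psi=\frac12\sum_{j=1}^n\Bigl((r_j+(z-c_j))\log(r_j+(z-c_j))+(r_j-(z-c_j))\log(r_j-(z-c_j))\Bigr)+C_1\mu_1+C_2\mu_2,$$ $$\psi^\vee=-\sum_{j=1}^n c_j\log(r_j-(z-c_j))+C_1\mu_1+C_2\mu_2 .$$
   Context: Products of $1$-forms in $g$ are symmetric products. Complex potential: write $g=\sum_{i,j=1}^2\bigl(\frac12 G_{ij}\,d\mu_i d\mu_j+2G^{ij}\,d\theta_i d\theta_j\bigr)$ with $(G_{ij})$ and $(G^{ij})$ symmetric and mutually inverse matrices of functions of $(\mu_1,\mu_2)$. A complex potential is a function $\psi$ of $(\mu_1,\mu_2)$ with $G_{ij}=\frac{\partial^2\psi}{\partial\mu_i\partial\mu_j}$ for $i,j=1,2$. Kähler potential: the Legendre transform of the complex potential, $\psi^\vee=\mu_1\frac{\partial\psi}{\partial\mu_1}+\mu_2\frac{\partial\psi}{\partial\mu_2}-\psi$. *)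

theory Defs
  imports "HOL-Analysis.Analysis"
begin


section \<open>Tensors on an open part of \<open>\<real>\<^sup>3 \<times> S\<^sup>1\<close>\<close>

text \<open>
  A point of \<open>\<real>\<^sup>3 \<times> S\<^sup>1\<close> is a pair of a vector \<open>(x, y, z)\<close> and a unit complex number.
  A tangent vector at \<open>p\<close> is \<open>(a, s)\<close>, standing for
  \<open>a\<^sub>1 \<partial>/\<partial>x + a\<^sub>2 \<partial>/\<partial>y + a\<^sub>3 \<partial>/\<partial>z + s \<partial>/\<partial>\<phi>\<close>, where \<open>\<partial>/\<partial>\<phi>\<close> is the velocity of
  \<open>t \<mapsto> e\<^sup>i\<^sup>t w\<close> at \<open>t = 0\<close>.
\<close>

type_synonym point = "(real ^ 3) \<times> complex"
type_synonym tangent = "(real ^ 3) \<times> real"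

definition chart :: "point \<Rightarrow> tangent \<Rightarrow> point" where
  "chart p v = (fst p + fst v, snd p * cis (snd v))"

text \<open>The differential at \<open>p\<close>, computed in the chart centred at \<open>p\<close>.\<close>

definition differential :: "(point \<Rightarrow> 'b::real_normed_vector) \<Rightarrow> point \<Rightarrow> tangent \<Rightarrow> 'b" where
  "differential F p = frechet_derivative (F \<circ> chart p) (at 0)"

definition sym_prod :: "(tangent \<Rightarrow> real) \<Rightarrow> (tangent \<Rightarrow> real) \<Rightarrow> tangent \<Rightarrow> tangent \<Rightarrow> real"
    (infixl "\<odot>" 75) where
  "(a \<odot> b) u v = (a u * b v + a v * b u) / 2"

definition wedge_prod :: "(tangent \<Rightarrow> real) \<Rightarrow> (tangent \<Rightarrow> real) \<Rightarrow> tangent \<Rightarrow> tangent \<Rightarrow> real"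
    (infixl "\<^bold>\<and>" 75) where
  "(a \<^bold>\<and> b) u v = a u * b v - a v * b u"

text \<open>
  \<open>\<Phi>\<close> is a system of local coordinates on \<open>W\<close>: every point of \<open>W\<close> has a neighbourhood
  which \<open>\<Phi>\<close> maps homeomorphically onto an open set, with everywhere invertible differential.
\<close>

definition local_coordinates :: "point set \<Rightarrow> (point \<Rightarrow> (real ^ 2) \<times> (real ^ 2)) \<Rightarrow> bool" where
  "local_coordinates W \<Phi> \<longleftrightarrow>
    (\<forall>p\<in>W. \<exists>N. p \<in> N \<and> openin (top_of_set W) N \<and> open (\<Phi> ` N) \<and>
      (\<exists>\<Psi>. homeomorphism N (\<Phi> ` N) \<Phi> \<Psi>) \<and>
      (\<forall>q\<in>N. (\<Phi> \<circ> chart q) differentiable (at 0) \<and> bij (differential \<Phi> q)))"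

section \<open>Complex and Kaehler potential\<close>

definition partial :: "2 \<Rightarrow> (real ^ 2 \<Rightarrow> real) \<Rightarrow> real ^ 2 \<Rightarrow> real" where
  "partial i f m = frechet_derivative f (at m) (axis i 1)"

definition complex_potential ::
  "point set \<Rightarrow> (point \<Rightarrow> tangent \<Rightarrow> tangent \<Rightarrow> real) \<Rightarrow>
    (point \<Rightarrow> real ^ 2) \<Rightarrow> (point \<Rightarrow> real ^ 2) \<Rightarrow> (real ^ 2 \<Rightarrow> real) \<Rightarrow> bool" where
  "complex_potential W g \<theta> \<mu> \<psi> \<longleftrightarrow>
    (\<exists>G H :: real ^ 2 \<Rightarrow> real ^ 2 ^ 2.
      (\<forall>m\<in>\<mu> ` W. transpose (G m) = G m \<and> transpose (H m) = H m \<and>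
         G m ** H m = mat 1 \<and> H m ** G m = mat 1) \<and>
      (\<forall>p\<in>W. \<forall>u v. g p u v =
         (\<Sum>i\<in>UNIV. \<Sum>j\<in>UNIV.
            1/2 * G (\<mu> p) $ i $ j *
              (differential (\<lambda>q. \<mu> q $ i) p \<odot> differential (\<lambda>q. \<mu> q $ j) p) u v +
            2 * H (\<mu> p) $ i $ j *
              (differential (\<lambda>q. \<theta> q $ i) p \<odot> differential (\<lambda>q. \<theta> q $ j) p) u v)) \<and>
      (\<forall>m\<in>\<mu> ` W. \<psi> differentiable (at m) \<and>
         (\<forall>i j. partial j \<psi> differentiable (at m) \<and>
                G m $ i $ j = partial i (partial j \<psi>) m)))"

definition kaehler_potential :: "(real ^ 2 \<Rightarrow> real) \<Rightarrow> real ^ 2 \<Rightarrow> real" where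
  "kaehler_potential \<psi> m = m $ 1 * partial 1 \<psi> m + m $ 2 * partial 2 \<psi> m - \<psi> m"

section \<open>The Gibbons-Hawking data\<close>

definition xc :: "point \<Rightarrow> real" where "xc p = fst p $ 1"
definition yc :: "point \<Rightarrow> real" where "yc p = fst p $ 2"
definition zc :: "point \<Rightarrow> real" where "zc p = fst p $ 3"

text \<open>The globally defined 1-form on the circle factor; it is the differential of every
  continuous local determination of the angle \<open>\<phi>\<close>.\<close>

definition dphi :: "tangent \<Rightarrow> real" where "dphi v = snd v"

definition rho :: "point \<Rightarrow> real" where
  "rho p = sqrt ((xc p)\<^sup>2 + (yc p)\<^sup>2)"

definition rad :: "(nat \<Rightarrow> real) \<Rightarrow> nat \<Rightarrow> point \<Rightarrow> real" where
  "rad c j p = sqrt ((xc p)\<^sup>2 + (yc p)\<^sup>2 + (zc p - c j)\<^sup>2)"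

definition GH_V :: "nat \<Rightarrow> (nat \<Rightarrow> real) \<Rightarrow> point \<Rightarrow> real" where
  "GH_V n c p = 1/2 * (\<Sum>j=1..n. 1 / rad c j p)"

definition GH_space :: "(nat \<Rightarrow> real) \<Rightarrow> point set" where
  "GH_space c = (UNIV - {a. a $ 1 = 0 \<and> a $ 2 = 0 \<and> a $ 3 \<ge> c 1}) \<times> sphere 0 1"

definition GH_alpha :: "nat \<Rightarrow> (nat \<Rightarrow> real) \<Rightarrow> point \<Rightarrow> tangent \<Rightarrow> real" where
  "GH_alpha n c p v =
    - 1/2 * (\<Sum>j=1..n. (xc p * differential yc p v - yc p * differential xc p v) /
                        (rad c j p * (rad c j p - (zc p - c j))))"

definition GH_metric :: "nat \<Rightarrow> (nat \<Rightarrow> real) \<Rightarrow> point \<Rightarrow> tangent \<Rightarrow> tangent \<Rightarrow> real" where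
  "GH_metric n c p u v =
    (let \<eta> = (\<lambda>w. dphi w + GH_alpha n c p w);
         dx = differential xc p; dy = differential yc p; dz = differential zc p
     in 1 / GH_V n c p * (\<eta> \<odot> \<eta>) u v +
        GH_V n c p * ((dx \<odot> dx) u v + (dy \<odot> dy) u v + (dz \<odot> dz) u v))"

definition GH_omega :: "nat \<Rightarrow> (nat \<Rightarrow> real) \<Rightarrow> point \<Rightarrow> tangent \<Rightarrow> tangent \<Rightarrow> real" where
  "GH_omega n c p u v =
    (let \<eta> = (\<lambda>w. dphi w + GH_alpha n c p w);
         dx = differential xc p; dy = differential yc p; dz = differential zc p
     in (\<eta> \<^bold>\<and> dz) u v + GH_V n c p * (dx \<^bold>\<and> dy) u v)"

definition GH_mu :: "nat \<Rightarrow> (nat \<Rightarrow> real) \<Rightarrow> point \<Rightarrow> real ^ 2" where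
  "GH_mu n c p = vector [- zc p, 1/2 * (\<Sum>j=1..n. rad c j p + zc p - c j)]"

text \<open>
  The coordinates \<open>\<theta>\<^sub>1 = \<phi>\<close> and \<open>\<theta>\<^sub>2 = arctan (y/x)\<close> are multi-valued. A determination of
  them on \<open>W\<close> is a continuous choice of \<open>\<theta>\<^sub>1\<close> with \<open>e\<^sup>i\<^sup>\<theta>\<^sup>1\<close> the circle component and of
  \<open>\<theta>\<^sub>2\<close> with \<open>tan \<theta>\<^sub>2 = y/x\<close>, cleared of denominators so as to include \<open>x = 0\<close>.
  The usual polar angle of \<open>(x, y)\<close> and the principal value \<open>arctan (y/x)\<close>, for \<open>x \<noteq> 0\<close>,
  are both of this kind.
\<close>

definition angle_coordinates :: "point set \<Rightarrow> (point \<Rightarrow> real ^ 2) \<Rightarrow> bool" where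
  "angle_coordinates W \<theta> \<longleftrightarrow> continuous_on W \<theta> \<and>
    (\<forall>p\<in>W. snd p = cis (\<theta> p $ 1) \<and> xc p * sin (\<theta> p $ 2) = yc p * cos (\<theta> p $ 2))"

lemma angle_coordinates_vector:
  assumes "continuous_on W a" "continuous_on W b"
    and "\<And>p. p \<in> W \<Longrightarrow> snd p = cis (a p)"
    and "\<And>p. p \<in> W \<Longrightarrow> xc p * sin (b p) = yc p * cos (b p)"
  shows "angle_coordinates W (\<lambda>p. vector [a p, b p])"
proof -
  have "(\<lambda>p. vector [a p, b p] :: real ^ 2) = (\<lambda>p. \<chi> i. if i = 1 then a p else b p)"
    by (auto simp: vec_eq_iff forall_2)
  moreover have "continuous_on W (\<lambda>p. (\<chi> i. if i = 1 then a p else b p) :: real ^ 2)"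
  proof (rule continuous_on_vec_lambda)
    show "continuous_on W (\<lambda>p. if i = 1 then a p else b p)" for i :: 2
      using assms(1,2) by (cases "i = 1") simp_all
  qed
  ultimately show ?thesis
    using assms(3,4) by (simp add: angle_coordinates_def)
qed

lemma angle_coordinates_arctan:
  assumes "continuous_on W a" "\<And>p. p \<in> W \<Longrightarrow> snd p = cis (a p)"
    and "\<And>p. p \<in> W \<Longrightarrow> xc p \<noteq> 0"
  shows "angle_coordinates W (\<lambda>p. vector [a p, arctan (yc p / xc p)])"
proof (rule angle_coordinates_vector)
  show "continuous_on W (\<lambda>p. arctan (yc p / xc p))"
    using assms(3) unfolding xc_def yc_def by (intro continuous_intros) auto
  show "xc p * sin (arctan (yc p / xc p)) = yc p * cos (arctan (yc p / xc p))" if "p \<in> W" for p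
    using assms(3)[OF that] by (simp add: sin_arctan cos_arctan)
qed (use assms in auto)

lemma angle_coordinates_exist:
  assumes "p \<in> GH_space c" "rho p > 0"
  shows "\<exists>W \<theta>. p \<in> W \<and> openin (top_of_set (GH_space c)) W \<and> W \<subseteq> {p. rho p > 0} \<and>
    angle_coordinates W \<theta>"
proof -
  define a where "a = (\<lambda>q::point. Im (Ln (snd q / snd p)) + Im (Ln (snd p)))"
  define A where "A = {q::point. Re (snd q / snd p) > 0}"
  have nz: "snd q \<noteq> 0" "norm (snd q) = 1" if "q \<in> GH_space c" for q
    using that by (auto simp: GH_space_def)
  have "open A"
    unfolding A_def by (intro open_Collect_less continuous_intros) (use nz[OF assms(1)] in auto)
  have a1: "continuous_on A a"
    unfolding a_def A_def using nz[OF assms(1)]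
    by (intro continuous_intros) (auto simp: complex_nonpos_Reals_iff)
  have a2: "snd q = cis (a q)" if "q \<in> GH_space c" for q
  proof -
    have cis_Ln: "cis (Im (Ln w)) = w" if "norm w = 1" for w
      using that exp_Ln[of w] exp_eq_polar[of "Ln w"]
      by (metis Re_Ln mult_1 norm_zero of_real_1 exp_zero ln_one zero_neq_one)
    have "norm (snd q / snd p) = 1"
      using nz[OF that] nz[OF assms(1)] by (simp add: norm_divide)
    then have "cis (a q) = snd q / snd p * snd p"
      unfolding a_def cis_mult[symmetric] using cis_Ln nz[OF assms(1)] by metis
    then show ?thesis using nz[OF assms(1)] by simp
  qed
  define b where "b = (\<lambda>q. if xc p \<noteq> 0 then arctan (yc q / xc q) else pi/2 - arctan (xc q / yc q))"
  define B where "B = {q. if xc p \<noteq> 0 then xc q \<noteq> 0 else yc q \<noteq> 0}"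
  have "open B"
    unfolding B_def xc_def yc_def by (cases "fst p $ 1 = 0") (auto intro!: open_Collect_neq continuous_intros)
  have b1: "continuous_on B b"
    unfolding b_def B_def xc_def yc_def
    by (cases "fst p $ 1 = 0") (auto intro!: continuous_intros)
  have b2: "xc q * sin (b q) = yc q * cos (b q)" if "q \<in> B" for q
    using that unfolding b_def B_def
    by (auto simp: sin_diff cos_diff sin_arctan cos_arctan split: if_splits)
  define W where "W = GH_space c \<inter> (A \<inter> B)"
  have "xc p \<noteq> 0 \<or> yc p \<noteq> 0"
    using assms(2) by (auto simp: rho_def)
  then have "p \<in> W"
    using assms(1) nz[OF assms(1)] by (auto simp: W_def A_def B_def)
  moreover have "openin (top_of_set (GH_space c)) W"
    unfolding W_def using \<open>open A\<close> \<open>open B\<close> by (simp add: openin_open_Int open_Int)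
  moreover have "W \<subseteq> {p. rho p > 0}"
    by (auto simp: W_def B_def rho_def sum_power2_gt_zero_iff split: if_splits)
  moreover have "angle_coordinates W (\<lambda>q. vector [a q, b q])"
  proof (rule angle_coordinates_vector)
    show "continuous_on W a" "continuous_on W b"
      using a1 b1 by (auto simp: W_def elim: continuous_on_subset)
  qed (auto simp: W_def a2 b2)
  ultimately show ?thesis by blast
qed

end

theory Submission
  imports Defs
begin

text \<open>
  Apart from the two angles, everything depends on a point only through \<open>q = (s, z)\<close> with
  \<open>s = x\<^sup>2 + y\<^sup>2 = \<rho>\<^sup>2\<close>, so the calculus takes place on the half-plane \<open>s > 0\<close>. Put
  \<open>a\<^sub>j = r\<^sub>j + (z - c\<^sub>j)\<close> and \<open>b\<^sub>j = r\<^sub>j - (z - c\<^sub>j)\<close>; both are positive and \<open>a\<^sub>j b\<^sub>j = s\<close>. Let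
  \<open>S\<close> be the sum of the \<open>1 / (r\<^sub>j b\<^sub>j)\<close>, so that \<open>s S\<close> is the sum of the \<open>a\<^sub>j / r\<^sub>j\<close>. Then
  \<open>d\<mu>\<^sub>1 = - dz\<close> and \<open>d\<mu>\<^sub>2 = (V/2) ds + (s S/2) dz\<close>.

  Forms. By definition of \<open>\<alpha>\<close>, \<open>d\<phi> + \<alpha> = d\<theta>\<^sub>1 - (s S/2) d\<theta>\<^sub>2\<close>, while solving for \<open>ds\<close> gives
  \<open>\<rho> d\<rho> = x dx + y dy = (d\<mu>\<^sub>2 + (s S/2) d\<mu>\<^sub>1) / V\<close>. Substituting these and
  \<open>dx\<^sup>2 + dy\<^sup>2 = d\<rho>\<^sup>2 + \<rho>\<^sup>2 d\<theta>\<^sub>2\<^sup>2\<close>, \<open>dx \<and> dy = \<rho> d\<rho> \<and> d\<theta>\<^sub>2\<close> turns the definitions of \<open>g\<close> and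
  \<open>\<omega>\<close> into the stated expressions (\<open>GH_metric_eq\<close>, \<open>GH_omega_eq\<close>).

  Potentials. For fixed \<open>z\<close> the function \<open>\<mu>\<^sub>2\<close> increases with \<open>s\<close>, so \<open>q \<mapsto> \<mu>\<close> is injective on the
  half-plane; by invariance of domain its image is open and its inverse continuous, hence
  differentiable with the derivative read off above (\<open>has_derivative_axial_of_mu\<close>). The function
  with the terms \<open>(a\<^sub>j log a\<^sub>j + b\<^sub>j log b\<^sub>j) / 2\<close>, transported to the \<open>\<mu>\<close>-plane, has as gradient,
  up to constants, the sum of the \<open>log b\<^sub>j\<close> and \<open>log s\<close>. The relation \<open>log a\<^sub>j = log s - log b\<^sub>j\<close> is
  what makes this work. Differentiating once more gives the matrix whose halves are the
  \<open>d\<mu>\<^sub>i d\<mu>\<^sub>j\<close>-coefficients of \<open>g\<close>, and twice its inverse gives the \<open>d\<theta>\<^sub>i d\<theta>\<^sub>j\<close>-coefficients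
  (\<open>complex_potential_GH_psi\<close>). A linear function has Legendre transform \<open>0\<close>, so the linear part
  of \<open>\<psi>\<close> is invisible in \<open>\<psi>\<^sup>\<or>\<close>; the transform of the logarithmic part produces the terms
  \<open>n \<mu>\<^sub>1 + 2 \<mu>\<^sub>2\<close>. Hence the same pair of constants serves for both potentials exactly when
  \<open>C\<^sub>1 = n\<close> and \<open>C\<^sub>2 = 2\<close> (\<open>kaehler_potential_GH_psi\<close>).

  Angles. A determination \<open>\<theta>\<close> is only given as a continuous function satisfying two
  trigonometric equations. After rotating the \<open>(x, y)\<close>-plane by \<open>\<theta>\<^sub>2(p)\<close>, the second equation
  determines \<open>\<theta>\<^sub>2\<close> near \<open>p\<close> as \<open>\<theta>\<^sub>2(p)\<close> plus an arctangent, and the first makes \<open>\<theta>\<^sub>1\<close> move with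
  the fibre angle (\<open>angles_near\<close>). This yields the differentials of the angles, and also local
  injectivity of \<open>(\<theta>, \<mu>)\<close>, which invariance of domain turns into the local homeomorphism property
  (\<open>local_coordinates_GH\<close>).
\<close>

section \<open>Calculus on the half-plane of axial invariants\<close>

lemma has_derivative_component:
  "((\<lambda>m::real ^ 'n. m $ i) has_derivative (\<lambda>k. k $ i)) F"
  by (rule bounded_linear_imp_has_derivative[OF bounded_linear_vec_nth])

lemma has_derivative_vector2:
  assumes "(f has_derivative f') F" "(g has_derivative g') F"
  shows "((\<lambda>x. vector [f x, g x] :: real ^ 2) has_derivative (\<lambda>h. vector [f' h, g' h])) F"
proof -
  have eq: "(vector [a, b] :: real ^ 2) = a *\<^sub>R axis 1 1 + b *\<^sub>R axis 2 1" for a b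
    by (simp add: vec_eq_iff forall_2 axis_def)
  show ?thesis
    unfolding eq by (intro derivative_intros assms)
qed

text \<open>The pair \<open>(s, z)\<close> with \<open>s = \<rho>\<^sup>2\<close> is used in place of \<open>(\<rho>, z)\<close>: the squared distances \<open>r\<^sub>j\<^sup>2\<close>
  are then linear in the first coordinate, and \<open>s\<close> is a polynomial in \<open>x\<close> and \<open>y\<close>, while \<open>\<mu>\<^sub>2\<close>
  is still increasing in \<open>s\<close>.\<close>

definition half_plane :: "(real \<times> real) set" where
  "half_plane = {0<..} \<times> UNIV"

definition axial_rad :: "real \<Rightarrow> real \<times> real \<Rightarrow> real" where
  "axial_rad d q = sqrt (fst q + (snd q - d)\<^sup>2)"

definition axial_V :: "nat \<Rightarrow> (nat \<Rightarrow> real) \<Rightarrow> real \<times> real \<Rightarrow> real" where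
  "axial_V n c q = 1/2 * (\<Sum>j=1..n. 1 / axial_rad (c j) q)"

definition axial_S :: "nat \<Rightarrow> (nat \<Rightarrow> real) \<Rightarrow> real \<times> real \<Rightarrow> real" where
  "axial_S n c q = (\<Sum>j=1..n. 1 / (axial_rad (c j) q * (axial_rad (c j) q - (snd q - c j))))"

text \<open>Up to an additive constant, the partial derivative of the complex potential along \<open>\<mu>\<^sub>1\<close>.\<close>

definition axial_L :: "nat \<Rightarrow> (nat \<Rightarrow> real) \<Rightarrow> real \<times> real \<Rightarrow> real" where
  "axial_L n c q = (\<Sum>j=1..n. ln (axial_rad (c j) q - (snd q - c j)))"

definition axial_mu :: "nat \<Rightarrow> (nat \<Rightarrow> real) \<Rightarrow> real \<times> real \<Rightarrow> real ^ 2" where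
  "axial_mu n c q = vector [- snd q, 1/2 * (\<Sum>j=1..n. axial_rad (c j) q + snd q - c j)]"

text \<open>The complex potential without its linear part.\<close>

definition axial_psi :: "nat \<Rightarrow> (nat \<Rightarrow> real) \<Rightarrow> real \<times> real \<Rightarrow> real" where
  "axial_psi n c q = 1/2 * (\<Sum>j=1..n.
     (axial_rad (c j) q + (snd q - c j)) * ln (axial_rad (c j) q + (snd q - c j)) +
     (axial_rad (c j) q - (snd q - c j)) * ln (axial_rad (c j) q - (snd q - c j)))"

lemma open_half_plane: "open half_plane"
  by (simp add: half_plane_def open_Times)

lemma in_half_plane: "q \<in> half_plane \<longleftrightarrow> fst q > 0"
  by (cases q) (simp add: half_plane_def)

lemma axial_rad_gt_abs: "fst q > 0 \<Longrightarrow> axial_rad d q > \<bar>snd q - d\<bar>"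
  unfolding axial_rad_def by (rule real_less_rsqrt) simp

lemma axial_rad_bounds:
  assumes "fst q > 0"
  shows "axial_rad d q > 0" "axial_rad d q + (snd q - d) > 0" "axial_rad d q - (snd q - d) > 0"
  using axial_rad_gt_abs[OF assms, of d] by linarith+

lemma axial_rad_product:
  assumes "fst q > 0"
  shows "(axial_rad d q + (snd q - d)) * (axial_rad d q - (snd q - d)) = fst q"
proof -
  have "(axial_rad d q)\<^sup>2 = fst q + (snd q - d)\<^sup>2"
    using assms by (simp add: axial_rad_def add_nonneg_nonneg)
  then show ?thesis by (simp add: algebra_simps power2_eq_square)
qed

text \<open>Taking logarithms in \<open>(r + (z - d)) (r - (z - d)) = s\<close> removes all \<open>log a\<^sub>j\<close> in favour of
  \<open>log s\<close>, which is the same for every \<open>j\<close> and can be pulled out of sums.\<close>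

lemma ln_axial_rad:
  assumes "fst q > 0"
  shows "ln (axial_rad d q + (snd q - d)) = ln (fst q) - ln (axial_rad d q - (snd q - d))"
  using axial_rad_product[OF assms, of d] axial_rad_bounds[OF assms, of d] by (metis add_diff_cancel ln_mult_pos)

text \<open>The terms \<open>a\<^sub>j / r\<^sub>j\<close> come from differentiating \<open>r\<^sub>j + z\<close>, whereas the metric is expressed by
  the \<open>1 / (r\<^sub>j b\<^sub>j)\<close>; this identity passes from one to the other.\<close>

lemma axial_rad_ratio:
  assumes "fst q > 0"
  shows "(axial_rad d q + (snd q - d)) / axial_rad d q = fst q * (1 / (axial_rad d q * (axial_rad d q - (snd q - d))))"
proof -
  have "a / r = a * b * (1 / (r * b))" if "b > 0" for a b r :: real
    using that by simp
  from this[OF axial_rad_bounds(3)[OF assms], of "axial_rad d q + (snd q - d)" "axial_rad d q" d] show ?thesis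
    unfolding axial_rad_product[OF assms] .
qed

lemma axial_V_pos: "n \<ge> 1 \<Longrightarrow> fst q > 0 \<Longrightarrow> axial_V n c q > 0"
  unfolding axial_V_def by (intro mult_pos_pos sum_pos) (auto simp: axial_rad_bounds)

lemma has_derivative_axial_rad:
  assumes "fst q > 0"
  shows "(axial_rad d has_derivative (\<lambda>h. (fst h / 2 + (snd q - d) * snd h) / axial_rad d q)) (at q)"
proof -
  have "fst q + (snd q - d)\<^sup>2 > 0" using assms by (simp add: add_pos_nonneg)
  then show ?thesis
    unfolding axial_rad_def
    by (auto intro!: derivative_eq_intros simp: fun_eq_iff field_simps)
qed

text \<open>Derivatives of sums are collected as one coefficient for \<open>ds\<close> and one for \<open>dz\<close>, so that the
  sums defining \<open>V\<close> and \<open>S\<close> can be recognised in the coefficients.\<close>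

lemma has_derivative_sum_pair:
  assumes "\<And>j. (f j has_derivative (\<lambda>h. a j * fst h + b j * snd h)) (at (q :: real \<times> real))"
  shows "((\<lambda>q. \<Sum>j\<in>A. f j q :: real) has_derivative
    (\<lambda>h. (\<Sum>j\<in>A. a j) * fst h + (\<Sum>j\<in>A. b j) * snd h)) (at q)"
  using has_derivative_sum[of A f "\<lambda>j h. a j * fst h + b j * snd h", OF assms]
  by (simp add: sum.distrib sum_distrib_right)

lemma has_derivative_axial_mu:
  assumes "fst q > 0"
  shows "(axial_mu n c has_derivative
    (\<lambda>h. vector [- snd h, axial_V n c q / 2 * fst h + fst q * axial_S n c q / 2 * snd h])) (at q)"
proof -
  have *: "((\<lambda>q. axial_rad d q + snd q - d) has_derivative
      (\<lambda>h. 1 / 2 * (1 / axial_rad d q) * fst h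
         + fst q * (1 / (axial_rad d q * (axial_rad d q - (snd q - d)))) * snd h)) (at q)" for d
    unfolding axial_rad_ratio[OF assms, symmetric]
    using axial_rad_bounds[OF assms, of d]
    by (auto intro!: derivative_eq_intros has_derivative_axial_rad[OF assms] simp: fun_eq_iff field_simps)
  show ?thesis
    unfolding axial_mu_def axial_V_def axial_S_def
    by (intro has_derivative_vector2 derivative_intros
        has_derivative_eq_rhs[OF has_derivative_mult_right[OF has_derivative_sum_pair[OF *]]],
        unfold sum_distrib_left[symmetric])
      (simp add: fun_eq_iff field_simps)
qed

text \<open>The vanishing \<open>dz\<close>-coefficient is kept so that the chain rule for functions of \<open>\<mu>\<close> below, which
  expects both coefficients, applies by unification.\<close>

lemma has_derivative_ln_fst:
  fixes q :: "real \<times> real"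
  assumes "fst q > 0"
  shows "((\<lambda>q. ln (fst q)) has_derivative (\<lambda>h. 1 / fst q * fst h + 0 * snd h)) (at q)"
  using assms by (auto intro!: derivative_eq_intros simp: fun_eq_iff field_simps)

lemma has_derivative_axial_L:
  assumes "fst q > 0"
  shows "(axial_L n c has_derivative (\<lambda>h. axial_S n c q / 2 * fst h + (- 2 * axial_V n c q) * snd h)) (at q)"
proof -
  have *: "((\<lambda>q. ln (axial_rad d q - (snd q - d))) has_derivative
      (\<lambda>h. 1 / 2 * (1 / (axial_rad d q * (axial_rad d q - (snd q - d)))) * fst h
        + (- 1) * (1 / axial_rad d q) * snd h)) (at q)" for d
    using axial_rad_bounds[OF assms, of d]
    apply (auto intro!: derivative_eq_intros has_derivative_axial_rad[OF assms] simp: fun_eq_iff )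
    by (simp add: divide_simps) (simp add: algebra_simps)
  show ?thesis
    unfolding axial_L_def axial_V_def axial_S_def
    by (rule has_derivative_eq_rhs[OF has_derivative_sum_pair[OF *]], unfold sum_distrib_left[symmetric])
      (simp add: fun_eq_iff)
qed

lemma has_derivative_x_ln_x:
  assumes "(f has_derivative f') (at q)" "f q > (0::real)"
  shows "((\<lambda>q. f q * ln (f q)) has_derivative (\<lambda>h. (ln (f q) + 1) * f' h)) (at q)"
  using assms by (auto intro!: derivative_eq_intros simp: fun_eq_iff algebra_simps)

text \<open>With \<open>log a = log s - log b\<close> and \<open>b / r = 2 - a / r\<close>, the derivative of
  \<open>(a log a + b log b) / 2\<close> becomes
  \<open>(log s + 2) / (4 r) ds + ((log s + 2) a / (2 r) - log b - 1) dz\<close>. Summing, the factor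
  \<open>log s + 2\<close> multiplies exactly \<open>(V/2) ds + (s S/2) dz\<close>, that is, \<open>d\<mu>\<^sub>2\<close>.\<close>

lemma has_derivative_axial_psi:
  assumes "fst q > 0"
  shows "(axial_psi n c has_derivative (\<lambda>h. (ln (fst q) + 2) * axial_V n c q / 2 * fst h
    + ((ln (fst q) + 2) * (fst q * axial_S n c q / 2) - axial_L n c q - real n) * snd h)) (at q)"
proof -
  have *: "((\<lambda>q. (axial_rad d q + (snd q - d)) * ln (axial_rad d q + (snd q - d)) +
      (axial_rad d q - (snd q - d)) * ln (axial_rad d q - (snd q - d))) has_derivative
      (\<lambda>h. ((ln (fst q) + 2) / 2) * (1 / axial_rad d q) * fst h
        + ((ln (fst q) + 2) * fst q * (1 / (axial_rad d q * (axial_rad d q - (snd q - d))))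
           - 2 * ln (axial_rad d q - (snd q - d)) - 2) * snd h)) (at q)" for d
  proof -
    have lin: "((\<lambda>q. snd q - d) has_derivative snd) (at q)"
      by (auto intro!: derivative_eq_intros)
    show ?thesis
      apply (rule has_derivative_eq_rhs[OF has_derivative_add[OF
          has_derivative_x_ln_x[OF has_derivative_add[OF has_derivative_axial_rad[OF assms] lin]
            axial_rad_bounds(2)[OF assms]]
          has_derivative_x_ln_x[OF has_derivative_diff[OF has_derivative_axial_rad[OF assms] lin]
            axial_rad_bounds(3)[OF assms]]]])
      unfolding ln_axial_rad[OF assms] mult.assoc axial_rad_ratio[OF assms, symmetric]
      using axial_rad_bounds[OF assms, of d]
      by (simp add: fun_eq_iff divide_simps) (simp add: algebra_simps)
  qed
  show ?thesis
    unfolding axial_psi_def axial_L_def axial_V_def axial_S_def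
    by (rule has_derivative_eq_rhs[OF has_derivative_mult_right[OF has_derivative_sum_pair[OF *]]],
        unfold sum_subtractf sum_distrib_left[symmetric])
      (simp add: fun_eq_iff field_simps)
qed

section \<open>Inverting the moment map\<close>

text \<open>The first component determines \<open>z\<close>, and at fixed \<open>z\<close> every \<open>r\<^sub>j\<close> increases strictly with \<open>s\<close>;
  \<open>n \<ge> 1\<close> provides at least one summand.\<close>

lemma inj_on_axial_mu:
  assumes "n \<ge> 1"
  shows "inj_on (axial_mu n c) half_plane"
proof (rule inj_onI)
  fix p q assume pq: "p \<in> half_plane" "q \<in> half_plane" and eq: "axial_mu n c p = axial_mu n c q"
  have z: "snd p = snd q"
    using arg_cong[OF eq, of "\<lambda>m. m $ 1"] by (simp add: axial_mu_def)
  have sum: "(\<Sum>j=1..n. axial_rad (c j) p + snd p - c j) = (\<Sum>j=1..n. axial_rad (c j) q + snd q - c j)"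
    using arg_cong[OF eq, of "\<lambda>m. m $ 2"] by (simp add: axial_mu_def)
  have less: "(\<Sum>j=1..n. axial_rad (c j) a + snd a - c j) < (\<Sum>j=1..n. axial_rad (c j) b + snd b - c j)"
    if "fst a < fst b" "snd a = snd b" for a b :: "real \<times> real"
    using assms that by (intro sum_strict_mono) (auto simp: axial_rad_def)
  have "\<not> fst p < fst q" "\<not> fst q < fst p"
    using less[of p q] less[of q p] z sum by linarith+
  then show "p = q"
    using z by (simp add: prod_eq_iff)
qed

lemma continuous_on_axial_mu: "continuous_on half_plane (axial_mu n c)"
proof (rule has_derivative_continuous_on)
  show "(axial_mu n c has_derivative
      (\<lambda>h. vector [- snd h, axial_V n c q / 2 * fst h + fst q * axial_S n c q / 2 * snd h]))
      (at q within half_plane)" if "q \<in> half_plane" for q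
    using has_derivative_at_withinI[OF has_derivative_axial_mu] that[unfolded in_half_plane] .
qed

definition axial_of_mu :: "nat \<Rightarrow> (nat \<Rightarrow> real) \<Rightarrow> real ^ 2 \<Rightarrow> real \<times> real" where
  "axial_of_mu n c = inv_into half_plane (axial_mu n c)"

lemma axial_of_mu_axial_mu: "n \<ge> 1 \<Longrightarrow> fst q > 0 \<Longrightarrow> axial_of_mu n c (axial_mu n c q) = q"
  by (simp add: axial_of_mu_def inv_into_f_f inj_on_axial_mu in_half_plane)

lemma open_image_axial_mu: "n \<ge> 1 \<Longrightarrow> open (axial_mu n c ` half_plane)"
  by (rule invariance_of_domain_gen[OF open_half_plane continuous_on_axial_mu inj_on_axial_mu]) auto

text \<open>Solving \<open>d\<mu>\<^sub>1 = - dz\<close>, \<open>d\<mu>\<^sub>2 = (V/2) ds + (s S/2) dz\<close> for \<open>ds\<close> and \<open>dz\<close>. Continuity of the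
  inverse, which the inverse rule for derivatives presupposes, comes from invariance of domain.\<close>

lemma has_derivative_axial_of_mu:
  assumes "n \<ge> 1" "fst q > 0"
  shows "(axial_of_mu n c has_derivative
    (\<lambda>k. (2 / axial_V n c q * (k $ 2 + fst q * axial_S n c q / 2 * k $ 1), - k $ 1))) (at (axial_mu n c q))"
proof (rule has_derivative_inverse_basic)
  show "(axial_mu n c has_derivative
    (\<lambda>h. vector [- snd h, axial_V n c q / 2 * fst h + fst q * axial_S n c q / 2 * snd h]))
    (at (axial_of_mu n c (axial_mu n c q)))"
    unfolding axial_of_mu_axial_mu[OF assms] by (rule has_derivative_axial_mu[OF assms(2)])
  show "bounded_linear
     (\<lambda>k::real^2. (2 / axial_V n c q * (k $ 2 + fst q * axial_S n c q / 2 * k $ 1), - k $ 1))"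
    by (intro bounded_linear_Pair bounded_linear_const_mult bounded_linear_add bounded_linear_minus
      bounded_linear_vec_nth)
  show "(\<lambda>k::real^2. (2 / axial_V n c q * (k $ 2 + fst q * axial_S n c q / 2 * k $ 1), - k $ 1)) \<circ>
     (\<lambda>h. vector [- snd h, axial_V n c q / 2 * fst h + fst q * axial_S n c q / 2 * snd h]) = id"
    using axial_V_pos[OF assms, of c] by (auto simp: fun_eq_iff field_simps)
  show "open (axial_mu n c ` half_plane)" "axial_mu n c q \<in> axial_mu n c ` half_plane"
    using assms by (auto simp: open_image_axial_mu in_half_plane)
  then show "continuous (at (axial_mu n c q)) (axial_of_mu n c)"
    using continuous_on_inverse_open[OF open_half_plane continuous_on_axial_mu, of "axial_of_mu n c" n c] assms
    by (auto simp: continuous_on_eq_continuous_at axial_of_mu_axial_mu in_half_plane)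
  show "axial_mu n c (axial_of_mu n c m) = m" if "m \<in> axial_mu n c ` half_plane" for m
    using that assms by (auto simp: axial_of_mu_axial_mu in_half_plane)
qed

lemma has_derivative_comp_axial_of_mu:
  assumes "n \<ge> 1" "fst q > 0"
    and "(f has_derivative (\<lambda>h. a * fst h + b * snd h)) (at q)"
  shows "((\<lambda>m. f (axial_of_mu n c m)) has_derivative
    (\<lambda>k. a * (2 / axial_V n c q) * (k $ 2 + fst q * axial_S n c q / 2 * k $ 1) - b * k $ 1)) (at (axial_mu n c q))"
proof -
  have "(f has_derivative (\<lambda>h. a * fst h + b * snd h)) (at (axial_of_mu n c (axial_mu n c q)))"
    using assms by (simp add: axial_of_mu_axial_mu)
  from has_derivative_compose[OF has_derivative_axial_of_mu[OF assms(1,2)] this]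
  show ?thesis by (simp add: algebra_simps)
qed

section \<open>The potentials as functions of the moment coordinates\<close>

text \<open>The linear part is dictated by the Kaehler potential: the Legendre transform annihilates it,
  but the transform of \<open>axial_psi\<close> contains \<open>n \<mu>\<^sub>1 + 2 \<mu>\<^sub>2\<close>, and the same constants are to appear
  in both potentials.\<close>

definition GH_psi :: "nat \<Rightarrow> (nat \<Rightarrow> real) \<Rightarrow> real ^ 2 \<Rightarrow> real" where
  "GH_psi n c m = axial_psi n c (axial_of_mu n c m) + real n * m $ 1 + 2 * m $ 2"

text \<open>By the previous formulas \<open>axial_psi\<close> has differential
  \<open>(log s + 2) d\<mu>\<^sub>2 + (\<Sum> log b\<^sub>j + n) d\<mu>\<^sub>1\<close>; the linear part adds \<open>n d\<mu>\<^sub>1 + 2 d\<mu>\<^sub>2\<close>.\<close>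

lemma has_derivative_GH_psi:
  assumes "n \<ge> 1" "fst q > 0"
  shows "(GH_psi n c has_derivative
    (\<lambda>k. (axial_L n c q + 2 * real n) * k $ 1 + (ln (fst q) + 4) * k $ 2)) (at (axial_mu n c q))"
  unfolding GH_psi_def
  by (rule has_derivative_eq_rhs[OF has_derivative_add[OF has_derivative_add[OF
      has_derivative_comp_axial_of_mu[OF assms has_derivative_axial_psi[OF assms(2)]]
      has_derivative_mult_right[OF has_derivative_component]]
      has_derivative_mult_right[OF has_derivative_component]]])
    (use axial_V_pos[OF assms, of c] in \<open>simp add: fun_eq_iff field_simps\<close>)

lemma partial_eq:
  assumes "(f has_derivative f') (at m)"
  shows "partial i f m = f' (axis i 1)"
  using frechet_derivative_at[OF assms] by (simp add: partial_def)

lemma axis_2: "axis (1::2) x $ 2 = 0" "axis (2::2) x $ 1 = 0" for x :: "'a::zero"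
  by (simp_all add: axis_def)

lemma partial_GH_psi:
  assumes "n \<ge> 1" "fst q > 0"
  shows "partial 1 (GH_psi n c) (axial_mu n c q) = axial_L n c q + 2 * real n"
    and "partial 2 (GH_psi n c) (axial_mu n c q) = ln (fst q) + 4"
  using partial_eq[OF has_derivative_GH_psi[OF assms, of c]] by (simp_all add: axis_2)

text \<open>The terms with \<open>log s\<close> cancel, because \<open>log a\<^sub>j = log s - log b\<^sub>j\<close> turns the logarithmic part
  of \<open>\<psi>\<close> into \<open>\<mu>\<^sub>2 log s + \<Sum> (c\<^sub>j - z) log b\<^sub>j\<close>, whose first term is also contained in
  \<open>\<mu>\<^sub>2 \<partial>\<psi>/\<partial>\<mu>\<^sub>2\<close>. The multiples of \<open>z\<close> cancel against \<open>\<mu>\<^sub>1 \<partial>\<psi>/\<partial>\<mu>\<^sub>1\<close> in the same way.\<close>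

lemma kaehler_potential_GH_psi:
  assumes "n \<ge> 1" "fst q > 0"
  shows "kaehler_potential (GH_psi n c) (axial_mu n c q) =
    - (\<Sum>j=1..n. c j * ln (axial_rad (c j) q - (snd q - c j)))
      + real n * axial_mu n c q $ 1 + 2 * axial_mu n c q $ 2"
proof -
  have "axial_psi n c q = (\<Sum>j=1..n. ln (fst q) / 2 * (axial_rad (c j) q + snd q - c j)
      + (c j - snd q) * ln (axial_rad (c j) q - (snd q - c j)))"
    unfolding axial_psi_def ln_axial_rad[OF assms(2)] sum_distrib_left
    by (intro sum.cong refl) (simp add: algebra_simps)
  then have "axial_psi n c q = ln (fst q) * axial_mu n c q $ 2
      + (\<Sum>j=1..n. c j * ln (axial_rad (c j) q - (snd q - c j))) - snd q * axial_L n c q"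
    unfolding axial_L_def axial_mu_def vector_2
    by (simp only: sum.distrib left_diff_distrib sum_subtractf sum_distrib_left[symmetric])
  moreover have "axial_mu n c q $ 1 = - snd q" by (simp add: axial_mu_def)
  ultimately show ?thesis
    unfolding kaehler_potential_def partial_GH_psi[OF assms] GH_psi_def axial_of_mu_axial_mu[OF assms]
    by (simp add: algebra_simps)
qed

text \<open>The first partial derivatives are known on the whole open image of the half-plane, hence agree
  near each of its points with functions that the chain rule differentiates.\<close>

lemma has_derivative_partial_GH_psi:
  assumes "n \<ge> 1" "fst q > 0"
  shows "(partial 1 (GH_psi n c) has_derivative
      (\<lambda>k. (2 * axial_V n c q + fst q * (axial_S n c q)\<^sup>2 / (2 * axial_V n c q)) * k $ 1
        + axial_S n c q / axial_V n c q * k $ 2)) (at (axial_mu n c q))" (is ?A)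
    and "(partial 2 (GH_psi n c) has_derivative
      (\<lambda>k. axial_S n c q / axial_V n c q * k $ 1 + 2 / (axial_V n c q * fst q) * k $ 2)) (at (axial_mu n c q))" (is ?B)
proof -
  have V: "axial_V n c q > 0" by (rule axial_V_pos[OF assms])
  have q: "axial_mu n c q \<in> axial_mu n c ` half_plane" using assms by (simp add: in_half_plane)
  have 1: "axial_L n c (axial_of_mu n c m) + 2 * real n = partial 1 (GH_psi n c) m"
    and 2: "ln (fst (axial_of_mu n c m)) + 4 = partial 2 (GH_psi n c) m" if "m \<in> axial_mu n c ` half_plane" for m
    using that assms(1) by (auto simp: in_half_plane partial_GH_psi axial_of_mu_axial_mu)
  show ?A
  proof (rule has_derivative_transform_within_open[OF _ open_image_axial_mu[OF assms(1)] q 1])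
    show "((\<lambda>m. axial_L n c (axial_of_mu n c m) + 2 * real n) has_derivative
       (\<lambda>k. (2 * axial_V n c q + fst q * (axial_S n c q)\<^sup>2 / (2 * axial_V n c q)) * k $ 1
        + axial_S n c q / axial_V n c q * k $ 2)) (at (axial_mu n c q))"
      apply (rule has_derivative_eq_rhs[OF has_derivative_add[OF
          has_derivative_comp_axial_of_mu[OF assms has_derivative_axial_L[OF assms(2)]] has_derivative_const]])
      using V by (simp add: fun_eq_iff field_simps power2_eq_square)
  qed
  show ?B
  proof (rule has_derivative_transform_within_open[OF _ open_image_axial_mu[OF assms(1)] q 2])
    show "((\<lambda>m. ln (fst (axial_of_mu n c m)) + 4) has_derivative
       (\<lambda>k. axial_S n c q / axial_V n c q * k $ 1 + 2 / (axial_V n c q * fst q) * k $ 2)) (at (axial_mu n c q))"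
      apply (rule has_derivative_eq_rhs[OF has_derivative_add[OF
          has_derivative_comp_axial_of_mu[OF assms has_derivative_ln_fst[OF assms(2)]] has_derivative_const]])
      using V assms(2) by (simp add: fun_eq_iff field_simps power2_eq_square)
  qed
qed

section \<open>Differentials at a point of the total space\<close>

definition axial :: "point \<Rightarrow> real \<times> real" where
  "axial p = ((xc p)\<^sup>2 + (yc p)\<^sup>2, zc p)"

lemma rad_eq: "rad c j p = axial_rad (c j) (axial p)"
  by (simp add: rad_def axial_rad_def axial_def)

lemma GH_V_eq: "GH_V n c p = axial_V n c (axial p)"
  by (simp add: GH_V_def axial_V_def rad_eq)

lemma GH_mu_eq: "GH_mu n c p = axial_mu n c (axial p)"
  by (simp add: GH_mu_def axial_mu_def rad_eq axial_def)

lemma rho_pos_iff: "rho p > 0 \<longleftrightarrow> fst (axial p) > 0"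
  by (simp add: rho_def axial_def)

lemma rho_power2: "(rho p)\<^sup>2 = fst (axial p)"
  by (simp add: rho_def axial_def)

lemma differential_eq:
  assumes "((\<lambda>v. F (chart p v)) has_derivative F') (at 0)"
  shows "differential F p = F'"
  using frechet_derivative_at[of "F \<circ> chart p" F' 0] assms by (simp add: differential_def o_def)

lemma chart_0 [simp]: "chart p 0 = p"
  by (simp add: chart_def)

lemma xyz_chart:
  "xc (chart p v) = xc p + fst v $ 1" "yc (chart p v) = yc p + fst v $ 2"
  "zc (chart p v) = zc p + fst v $ 3"
  by (simp_all add: xc_def yc_def zc_def chart_def)

lemma has_derivative_xyz:
  "((\<lambda>v. xc (chart p v)) has_derivative (\<lambda>v. fst v $ 1)) (at 0)"
  "((\<lambda>v. yc (chart p v)) has_derivative (\<lambda>v. fst v $ 2)) (at 0)"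
  "((\<lambda>v. zc (chart p v)) has_derivative (\<lambda>v. fst v $ 3)) (at 0)"
  unfolding xyz_chart
  by (auto intro!: derivative_eq_intros bounded_linear.has_derivative[OF bounded_linear_vec_nth])

lemma differential_xyz:
  "differential xc p = (\<lambda>v. fst v $ 1)" "differential yc p = (\<lambda>v. fst v $ 2)"
  "differential zc p = (\<lambda>v. fst v $ 3)"
  by (rule differential_eq has_derivative_xyz)+

lemma has_derivative_axial:
  "((\<lambda>v. axial (chart p v)) has_derivative
    (\<lambda>v. (2 * (xc p * fst v $ 1 + yc p * fst v $ 2), fst v $ 3))) (at 0)"
proof -
  have "((\<lambda>v. (xc (chart p v))\<^sup>2 + (yc (chart p v))\<^sup>2) has_derivative
    (\<lambda>v. 2 * (xc p * fst v $ 1 + yc p * fst v $ 2))) (at 0)"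
    by (rule has_derivative_eq_rhs[OF has_derivative_add[OF
        has_derivative_power[OF has_derivative_xyz(1)] has_derivative_power[OF has_derivative_xyz(2)]]])
      (simp add: fun_eq_iff algebra_simps)
  then show ?thesis
    unfolding axial_def by (rule has_derivative_Pair[OF _ has_derivative_xyz(3)])
qed

text \<open>The differential of \<open>\<mu>\<close> in terms of \<open>dx, dy, dz\<close>, using \<open>ds = 2 (x dx + y dy)\<close>.\<close>

definition mu_diff :: "nat \<Rightarrow> (nat \<Rightarrow> real) \<Rightarrow> point \<Rightarrow> tangent \<Rightarrow> real ^ 2" where
  "mu_diff n c p v = vector [- fst v $ 3,
     axial_V n c (axial p) * (xc p * fst v $ 1 + yc p * fst v $ 2)
     + fst (axial p) * axial_S n c (axial p) / 2 * fst v $ 3]"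

lemma has_derivative_GH_mu:
  assumes "fst (axial p) > 0"
  shows "((\<lambda>v. GH_mu n c (chart p v)) has_derivative mu_diff n c p) (at 0)"
proof -
  have "(axial_mu n c has_derivative (\<lambda>h. vector [- snd h,
      axial_V n c (axial p) / 2 * fst h + fst (axial p) * axial_S n c (axial p) / 2 * snd h]))
      (at (axial (chart p 0)))"
    using has_derivative_axial_mu[OF assms] by simp
  from has_derivative_compose[OF has_derivative_axial this]
  show ?thesis
    unfolding GH_mu_eq
    by (rule has_derivative_eq_rhs) (simp add: fun_eq_iff mu_diff_def vec_eq_iff forall_2 field_simps)
qed

lemma differential_GH_mu:
  assumes "fst (axial p) > 0"
  shows "differential (\<lambda>q. GH_mu n c q $ i) p = (\<lambda>v. mu_diff n c p v $ i)"
  by (intro differential_eq bounded_linear.has_derivative[OF bounded_linear_vec_nth]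
      has_derivative_GH_mu assms)

section \<open>Determinations of the angles\<close>

lemma cis_eq_1_imp_0:
  assumes "cis d = 1" "\<bar>d\<bar> < 2 * pi"
  shows "d = 0"
proof -
  have "cos d = 1" using arg_cong[OF assms(1), of Re] by simp
  then obtain k :: int where k: "d = of_int k * 2 * pi"
    unfolding cos_one_2pi_int by blast
  then have "\<bar>of_int k :: real\<bar> * (2 * pi) < 1 * (2 * pi)"
    using assms(2) by (simp add: abs_mult)
  then have "\<bar>of_int k :: real\<bar> < 1"
    by (simp only: mult_less_cancel_right) simp
  then have "k = 0" by linarith
  then show ?thesis using k by simp
qed

text \<open>The coordinates of \<open>(x, y)\<close> in the frame rotated by the angle \<open>t\<close>. With \<open>t = \<theta>\<^sub>2(p)\<close>, the point
  \<open>p\<close> itself lies on the first axis of the rotated frame, away from the origin, so that near \<open>p\<close>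
  the angle relative to \<open>t\<close> is the arctangent of a quotient with non-vanishing denominator.\<close>

definition rot_X :: "real \<Rightarrow> point \<Rightarrow> real" where
  "rot_X t p = xc p * cos t + yc p * sin t"

definition rot_Y :: "real \<Rightarrow> point \<Rightarrow> real" where
  "rot_Y t p = yc p * cos t - xc p * sin t"

lemma rot_norm: "(rot_X t p)\<^sup>2 + (rot_Y t p)\<^sup>2 = fst (axial p)"
proof -
  have "(rot_X t p)\<^sup>2 + (rot_Y t p)\<^sup>2 = ((xc p)\<^sup>2 + (yc p)\<^sup>2) * ((sin t)\<^sup>2 + (cos t)\<^sup>2)"
    unfolding rot_X_def rot_Y_def by algebra
  then show ?thesis by (simp add: axial_def)
qed

lemma rot_recover:
  "xc p = rot_X t p * cos t - rot_Y t p * sin t" "yc p = rot_X t p * sin t + rot_Y t p * cos t"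
proof -
  have "rot_X t p * cos t - rot_Y t p * sin t = xc p * ((sin t)\<^sup>2 + (cos t)\<^sup>2)"
    "rot_X t p * sin t + rot_Y t p * cos t = yc p * ((sin t)\<^sup>2 + (cos t)\<^sup>2)"
    unfolding rot_X_def rot_Y_def by algebra+
  then show "xc p = rot_X t p * cos t - rot_Y t p * sin t" "yc p = rot_X t p * sin t + rot_Y t p * cos t"
    by simp_all
qed

lemma continuous_chart: "continuous (at v) (chart p)"
  unfolding chart_def cis_conv_exp by (intro continuous_intros)

text \<open>The chart never leaves the unit circle, and \<open>GH_space\<close> restricts the \<open>\<real>\<^sup>3\<close>-component to an open
  set, so a relatively open piece pulls back to a neighbourhood of \<open>0\<close>.\<close>

lemma continuous_on_chart: "continuous_on S (chart p)"
  using continuous_chart by (blast intro: continuous_at_imp_continuous_on)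

lemma chart_in_open_piece:
  assumes "openin (top_of_set (GH_space c)) W" "p \<in> W"
  shows "\<forall>\<^sub>F v in nhds 0. chart p v \<in> W"
proof -
  obtain T where T: "open T" "W = GH_space c \<inter> T"
    using assms(1) by (auto simp: openin_open)
  define A :: "(real ^ 3) set" where "A = UNIV - {a. a $ 1 = 0 \<and> a $ 2 = 0 \<and> a $ 3 \<ge> c 1}"
  have "closed {a :: real ^ 3. a $ 1 = 0 \<and> a $ 2 = 0 \<and> a $ 3 \<ge> c 1}"
    by (intro closed_Collect_conj closed_Collect_eq closed_Collect_le continuous_intros)
  then have A: "open (T \<inter> A \<times> UNIV)"
    using T(1) unfolding A_def by (intro open_Int open_Times) auto
  have p: "p \<in> T \<inter> A \<times> UNIV" "norm (snd p) = 1"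
    using assms(2) by (auto simp: T(2) GH_space_def A_def)
  have "(chart p \<longlongrightarrow> chart p 0) (nhds 0)"
    using continuous_chart[of 0 p] tendsto_at_iff_tendsto_nhds[of "chart p" 0]
    unfolding continuous_at by blast
  then have "\<forall>\<^sub>F v in nhds 0. chart p v \<in> T \<inter> A \<times> UNIV"
    using A p(1) by (auto dest: topological_tendstoD)
  then show ?thesis
  proof eventually_elim
    case (elim v)
    have "norm (snd (chart p v)) = 1"
      using p(2) by (simp add: chart_def norm_mult)
    then show ?case
      using elim by (cases "chart p v") (auto simp: T(2) GH_space_def A_def)
  qed
qed

text \<open>The defining equations fix \<open>\<theta>\<^sub>1\<close> modulo \<open>2 \<pi>\<close> and \<open>\<theta>\<^sub>2\<close> modulo \<open>\<pi>\<close>. Continuity keeps the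
  increments from \<open>p\<close> small enough to remove both ambiguities. The sign condition on \<open>rot_X\<close>
  records on which of the two half-planes the point lies; \<open>\<theta>\<^sub>2\<close> alone cannot distinguish
  \<open>(x, y)\<close> from \<open>(- x, - y)\<close>.\<close>

lemma angles_near:
  assumes W: "openin (top_of_set (GH_space c)) W" "angle_coordinates W \<theta>"
    and p: "p \<in> W" "fst (axial p) > 0"
  shows "\<forall>\<^sub>F v in nhds 0. chart p v \<in> W \<and> \<theta> (chart p v) $ 1 = \<theta> p $ 1 + snd v \<and>
    rot_X (\<theta> p $ 2) (chart p v) * rot_X (\<theta> p $ 2) p > 0 \<and>
    \<theta> (chart p v) $ 2 =
      \<theta> p $ 2 + arctan (rot_Y (\<theta> p $ 2) (chart p v) / rot_X (\<theta> p $ 2) (chart p v))"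
proof -
  let ?t = "\<theta> p $ 2"
  have rot: "snd q = cis (\<theta> q $ 1)" "xc q * sin (\<theta> q $ 2) = yc q * cos (\<theta> q $ 2)" if "q \<in> W" for q
    using W(2) that by (auto simp: angle_coordinates_def)
  have "rot_Y ?t p = 0"
    using rot(2)[OF p(1)] by (simp add: rot_Y_def)
  then have Xp: "rot_X ?t p \<noteq> 0"
    using rot_norm[of ?t p] p(2) by auto
  obtain S where S: "open S" "0 \<in> S" "\<And>v. v \<in> S \<Longrightarrow> chart p v \<in> W"
    using chart_in_open_piece[OF W(1) p(1)] unfolding eventually_nhds by blast
  have "continuous_on S (\<lambda>v. \<theta> (chart p v))"
  proof (rule continuous_on_compose2[of W])
    show "continuous_on W \<theta>" using W(2) by (simp add: angle_coordinates_def)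
    show "continuous_on S (chart p)" by (rule continuous_on_chart)
  qed (use S in auto)
  then have "isCont (\<lambda>v. \<theta> (chart p v)) 0"
    using S by (simp add: continuous_on_eq_continuous_at)
  then have lim: "((\<lambda>v. \<theta> (chart p v)) \<longlongrightarrow> \<theta> p) (nhds 0)"
    using tendsto_at_iff_tendsto_nhds[of "\<lambda>v. \<theta> (chart p v)" 0] by (simp add: continuous_at)
  have lim_i: "((\<lambda>v. \<theta> (chart p v) $ i - \<theta> p $ i) \<longlongrightarrow> 0) (nhds 0)" for i
    using tendsto_diff[OF tendsto_vec_nth[OF lim, of i] tendsto_const[of "\<theta> p $ i"]] by simp
  have small: "\<forall>\<^sub>F v in nhds 0. \<bar>\<theta> (chart p v) $ i - \<theta> p $ i\<bar> < pi / 2" for i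
    using tendstoD[OF lim_i, of "pi / 2" i] by (simp add: dist_real_def)
  have small': "\<forall>\<^sub>F v in nhds 0. \<bar>snd (v :: tangent)\<bar> < pi"
  proof -
    have "((\<lambda>v::tangent. snd v) \<longlongrightarrow> 0) (nhds 0)"
      using tendsto_snd[OF tendsto_ident_at[of "0::tangent" UNIV]]
      using tendsto_at_iff_tendsto_nhds[of "snd :: tangent \<Rightarrow> real" 0] by simp
    from tendstoD[OF this, of pi] show ?thesis by (simp add: dist_real_def)
  qed
  have "isCont (\<lambda>v. rot_X ?t (chart p v) * rot_X ?t p) 0"
    unfolding rot_X_def xyz_chart by (intro continuous_intros)
  then have "((\<lambda>v. rot_X ?t (chart p v) * rot_X ?t p) \<longlongrightarrow> rot_X ?t p * rot_X ?t p) (nhds 0)"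
    using tendsto_at_iff_tendsto_nhds[of "\<lambda>v. rot_X ?t (chart p v) * rot_X ?t p" 0]
    by (simp add: continuous_at)
  then have X: "\<forall>\<^sub>F v in nhds 0. rot_X ?t (chart p v) * rot_X ?t p > 0"
    by (rule order_tendstoD) (use Xp in \<open>auto simp: zero_less_mult_iff\<close>)
  have "\<forall>\<^sub>F v in nhds 0. v \<in> S"
    using S by (auto simp: eventually_nhds)
  then show ?thesis
    using small[of 1] small[of 2] small' X
  proof eventually_elim
    case (elim v)
    have W': "chart p v \<in> W" using elim(1) by (rule S)
    have "cis (\<theta> (chart p v) $ 1) = snd p * cis (snd v)"
      using rot(1)[OF W'] by (simp add: chart_def)
    also have "\<dots> = cis (\<theta> p $ 1 + snd v)"
      using rot(1)[OF p(1)] by (simp add: cis_mult)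
    finally have "cis (\<theta> (chart p v) $ 1 - (\<theta> p $ 1 + snd v)) = 1"
      by (simp flip: cis_divide)
    moreover have "\<bar>\<theta> (chart p v) $ 1 - (\<theta> p $ 1 + snd v)\<bar> < 2 * pi"
      using elim(2,4) by linarith
    ultimately have 1: "\<theta> (chart p v) $ 1 = \<theta> p $ 1 + snd v"
      using cis_eq_1_imp_0 by fastforce
    let ?d = "\<theta> (chart p v) $ 2 - ?t"
    have X0: "rot_X ?t (chart p v) \<noteq> 0" using elim(5) by auto
    have cd: "cos ?d > 0"
      using elim(3) by (intro cos_gt_zero_pi) linarith+
    \<comment> \<open>the equation \<open>x sin \<theta>\<^sub>2 = y cos \<theta>\<^sub>2\<close> is invariant under rotating the plane and the angle together\<close>
    have "rot_X ?t (chart p v) * sin ?d - rot_Y ?t (chart p v) * cos ?d =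
       (xc (chart p v) * sin (\<theta> (chart p v) $ 2) - yc (chart p v) * cos (\<theta> (chart p v) $ 2)) *
       ((sin ?t)\<^sup>2 + (cos ?t)\<^sup>2)"
      unfolding rot_X_def rot_Y_def sin_diff cos_diff by algebra
    also have "\<dots> = 0" using rot(2)[OF W'] by simp
    finally have "tan ?d = rot_Y ?t (chart p v) / rot_X ?t (chart p v)"
      using cd X0 by (simp add: tan_def field_simps)
    moreover have "- (pi / 2) < ?d" "?d < pi / 2"
      using elim(3) by linarith+
    ultimately have "?d = arctan (rot_Y ?t (chart p v) / rot_X ?t (chart p v))"
      using arctan_tan[of ?d] by simp
    then show ?case using W' 1 elim(5) by simp
  qed
qed

text \<open>Any two determinations of the angles differ by locally constant functions, so this one formula
  serves as the differential of all of them.\<close>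

definition theta_diff :: "point \<Rightarrow> tangent \<Rightarrow> real ^ 2" where
  "theta_diff p v = vector [snd v, (xc p * fst v $ 2 - yc p * fst v $ 1) / fst (axial p)]"

lemma has_derivative_theta:
  assumes W: "openin (top_of_set (GH_space c)) W" "angle_coordinates W \<theta>"
    and p: "p \<in> W" "fst (axial p) > 0"
  shows "((\<lambda>v. \<theta> (chart p v)) has_derivative theta_diff p) (at 0)"
proof -
  let ?t = "\<theta> p $ 2"
  let ?X = "\<lambda>v. rot_X ?t (chart p v)" and ?Y = "\<lambda>v. rot_Y ?t (chart p v)"
  let ?f = "\<lambda>v. vector [\<theta> p $ 1 + snd v, ?t + arctan (?Y v / ?X v)] :: real ^ 2"
  obtain S where S: "open S" "0 \<in> S" and eq: "\<And>v. v \<in> S \<Longrightarrow> ?f v = \<theta> (chart p v)"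
  proof -
    from angles_near[OF assms] obtain S where S: "open S" "0 \<in> S"
      "\<And>v. v \<in> S \<Longrightarrow> \<theta> (chart p v) $ 1 = \<theta> p $ 1 + snd v \<and> \<theta> (chart p v) $ 2 = ?t + arctan (?Y v / ?X v)"
      unfolding eventually_nhds by blast
    show ?thesis by (rule that[OF S(1,2)]) (simp add: S(3) vec_eq_iff forall_2)
  qed
  have Y0: "rot_Y ?t p = 0"
    using W(2) p(1) by (auto simp: angle_coordinates_def rot_Y_def)
  then have X0: "(rot_X ?t p)\<^sup>2 = fst (axial p)" "rot_X ?t p \<noteq> 0"
    using rot_norm[of ?t p] p(2) by auto
  have dX: "(?X has_derivative (\<lambda>v. fst v $ 1 * cos ?t + fst v $ 2 * sin ?t)) (at 0)"
    and dY: "(?Y has_derivative (\<lambda>v. fst v $ 2 * cos ?t - fst v $ 1 * sin ?t)) (at 0)"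
    unfolding rot_X_def rot_Y_def
    by (intro derivative_intros has_derivative_xyz)+
  have "((\<lambda>v. arctan (?Y v / ?X v)) has_derivative
      (\<lambda>v. (xc p * fst v $ 2 - yc p * fst v $ 1) / fst (axial p))) (at 0)"
    apply (rule has_derivative_eq_rhs[OF has_derivative_arctan[OF has_derivative_divide[OF dY dX]]])
    using X0 apply simp
    \<comment> \<open>at \<open>p\<close> one has \<open>Y = 0\<close>, so \<open>(x, y) = X (cos t, sin t)\<close> and \<open>X\<^sup>2 = \<rho>\<^sup>2\<close>\<close>
    unfolding X0(1)[symmetric] rot_recover[of p ?t]
    using X0(2) by (simp add: fun_eq_iff Y0 field_simps power2_eq_square)
  then have "((\<lambda>v. ?t + arctan (?Y v / ?X v)) has_derivative
      (\<lambda>v. (xc p * fst v $ 2 - yc p * fst v $ 1) / fst (axial p))) (at 0)"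
    using has_derivative_add[OF has_derivative_const] by fastforce
  moreover have "((\<lambda>v. \<theta> p $ 1 + snd v) has_derivative snd) (at (0::tangent))"
    by (auto intro!: derivative_eq_intros)
  ultimately have "(?f has_derivative theta_diff p) (at 0)"
    unfolding theta_diff_def[abs_def] by (intro has_derivative_vector2)
  then show ?thesis
    by (rule has_derivative_transform_within_open[OF _ S eq])
qed

lemma differential_theta:
  assumes "openin (top_of_set (GH_space c)) W" "angle_coordinates W \<theta>" "p \<in> W" "fst (axial p) > 0"
  shows "differential (\<lambda>q. \<theta> q $ i) p = (\<lambda>v. theta_diff p v $ i)"
  by (intro differential_eq bounded_linear.has_derivative[OF bounded_linear_vec_nth]
      has_derivative_theta[OF assms])

section \<open>Local coordinates\<close>

text \<open>The inverse is explicit: \<open>d\<mu>\<close> recovers \<open>dz\<close> and \<open>R = x dx + y dy\<close>, then \<open>R\<close> and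
  \<open>T = d\<theta>\<^sub>2\<close> recover \<open>dx = x R / s - y T\<close> and \<open>dy = y R / s + x T\<close>.\<close>

lemma bij_coordinate_differential:
  assumes "n \<ge> 1" "fst (axial p) > 0"
  shows "bij (\<lambda>v. (theta_diff p v, mu_diff n c p v))"
proof -
  define s V A where "s = fst (axial p)" and "V = axial_V n c (axial p)"
    and "A = fst (axial p) * axial_S n c (axial p) / 2"
  have pos: "s > 0" "V > 0" using assms axial_V_pos by (auto simp: s_def V_def)
  have s: "s = xc p * xc p + yc p * yc p" by (simp add: s_def axial_def power2_eq_square)
  define back_map :: "(real ^ 2) \<times> (real ^ 2) \<Rightarrow> tangent"
    where "back_map = (\<lambda>w. let R = (snd w $ 2 + A * snd w $ 1) / V; T = fst w $ 2
       in (vector [xc p * R / s - yc p * T, yc p * R / s + xc p * T, - snd w $ 1], fst w $ 1))"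
  have 1: "back_map (theta_diff p v, mu_diff n c p v) = v" for v
  proof -
    define a b where "a = fst v $ 1" and "b = fst v $ 2"
    have R: "(mu_diff n c p v $ 2 + A * mu_diff n c p v $ 1) / V = xc p * a + yc p * b"
      using pos(2) by (simp add: mu_diff_def A_def V_def a_def b_def)
    have T: "theta_diff p v $ 2 = (xc p * b - yc p * a) / s" "theta_diff p v $ 1 = snd v"
      "mu_diff n c p v $ 1 = - fst v $ 3"
      by (simp_all add: theta_diff_def mu_diff_def a_def b_def s_def)
    have "xc p * (xc p * a + yc p * b) / s - yc p * ((xc p * b - yc p * a) / s) = a"
      "yc p * (xc p * a + yc p * b) / s + xc p * ((xc p * b - yc p * a) / s) = b"
      using pos by (simp_all add: divide_simps) (simp_all add: s algebra_simps)
    then show ?thesis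
      unfolding back_map_def Let_def fst_conv snd_conv R unfolding T
      by (simp add: prod_eq_iff vec_eq_iff forall_3 a_def b_def)
  qed
  have 2: "(theta_diff p (back_map w), mu_diff n c p (back_map w)) = w" for w
  proof -
    define R T where "R = (snd w $ 2 + A * snd w $ 1) / V" and "T = fst w $ 2"
    have "(xc p * (yc p * R / s + xc p * T) - yc p * (xc p * R / s - yc p * T)) / s = T"
      "xc p * (xc p * R / s - yc p * T) + yc p * (yc p * R / s + xc p * T) = R"
      using pos by (simp_all add: divide_simps) (simp_all add: s algebra_simps)
    moreover have "V * R - A * snd w $ 1 = snd w $ 2"
      using pos by (simp add: R_def)
    moreover have "back_map w = (vector [xc p * R / s - yc p * T, yc p * R / s + xc p * T, - snd w $ 1], fst w $ 1)"
      by (simp add: back_map_def R_def T_def Let_def)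
    ultimately show ?thesis
      by (simp add: theta_diff_def mu_diff_def prod_eq_iff vec_eq_iff forall_2 T_def
          flip: s_def V_def) (simp add: A_def s_def)
  qed
  show ?thesis
    by (rule o_bij[of back_map]) (simp_all add: fun_eq_iff 1 2)
qed

text \<open>Near \<open>p\<close> the values of \<open>\<mu>\<close> determine \<open>\<rho>\<close> and \<open>z\<close>, those of \<open>\<theta>\<close> determine the fibre angle and
  the line through \<open>(x, y)\<close>, and the sign of \<open>rot_X\<close> determines the ray. So \<open>(\<theta>, \<mu>)\<close> is injective in
  the chart centred at \<open>p\<close>, and invariance of domain makes it a homeomorphism onto an open set.\<close>

lemma local_coordinates_GH:
  assumes n: "n \<ge> 1" and W: "openin (top_of_set (GH_space c)) W" "W \<subseteq> {p. rho p > 0}"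
    and \<theta>: "angle_coordinates W \<theta>"
  shows "local_coordinates W (\<lambda>p. (\<theta> p, GH_mu n c p))"
  unfolding local_coordinates_def
proof
  fix p assume p: "p \<in> W"
  define \<Phi> where "\<Phi> = (\<lambda>p. (\<theta> p, GH_mu n c p))"
  define K where "K = (\<lambda>v. \<Phi> (chart p v))"
  let ?t = "\<theta> p $ 2"
  have pos: "fst (axial q) > 0" if "q \<in> W" for q
    using W(2) that rho_pos_iff by auto
  have deriv: "((\<lambda>v. \<Phi> (chart q v)) has_derivative (\<lambda>v. (theta_diff q v, mu_diff n c q v))) (at 0)"
    if "q \<in> W" for q
    unfolding \<Phi>_def using that W(1) \<theta> pos
    by (intro has_derivative_Pair has_derivative_theta has_derivative_GH_mu) auto
  have cont_\<Phi>: "continuous_on W \<Phi>"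
  proof -
    have "continuous_on W \<theta>" using \<theta> by (simp add: angle_coordinates_def)
    moreover have "continuous_on W (GH_mu n c)"
      unfolding GH_mu_eq
    proof (rule continuous_on_compose2[OF continuous_on_axial_mu])
      show "continuous_on W axial"
        unfolding axial_def xc_def yc_def zc_def by (intro continuous_intros)
    qed (use pos in \<open>auto simp: in_half_plane\<close>)
    ultimately show ?thesis
      unfolding \<Phi>_def by (intro continuous_on_Pair)
  qed
  obtain B where B: "open B" "0 \<in> B" and near:
    "\<And>v. v \<in> B \<Longrightarrow> chart p v \<in> W \<and> \<theta> (chart p v) $ 1 = \<theta> p $ 1 + snd v \<and>
      rot_X ?t (chart p v) * rot_X ?t p > 0 \<and>
      \<theta> (chart p v) $ 2 = ?t + arctan (rot_Y ?t (chart p v) / rot_X ?t (chart p v))"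
    using angles_near[OF W(1) \<theta> p pos[OF p]] unfolding eventually_nhds by blast
  have cont_K: "continuous_on B K"
    unfolding K_def
    by (rule continuous_on_compose2[OF cont_\<Phi>])
      (use near in \<open>auto simp: continuous_on_chart\<close>)
  have inj_K: "inj_on K B"
  proof (rule inj_onI)
    fix v w assume vw: "v \<in> B" "w \<in> B" and "K v = K w"
    then have th: "\<theta> (chart p v) = \<theta> (chart p w)"
      and mu: "axial_mu n c (axial (chart p v)) = axial_mu n c (axial (chart p w))"
      by (auto simp: K_def \<Phi>_def GH_mu_eq)
    have axial: "axial (chart p v) = axial (chart p w)"
      using inj_onD[OF inj_on_axial_mu[OF n] mu] near pos vw by (auto simp: in_half_plane)
    let ?X = "\<lambda>v. rot_X ?t (chart p v)" and ?Y = "\<lambda>v. rot_Y ?t (chart p v)"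
    have X: "?X v * rot_X ?t p > 0" "?X w * rot_X ?t p > 0"
      using near vw by auto
    then have X0: "?X v \<noteq> 0" "?X w \<noteq> 0" "?X v * ?X w > 0"
      by (auto simp: zero_less_mult_iff)
    have "arctan (?Y v / ?X v) = arctan (?Y w / ?X w)"
      using near[OF vw(1)] near[OF vw(2)] th by simp
    then have ratio: "?Y v / ?X v = ?Y w / ?X w"
      by (simp add: arctan_eq_iff)
    \<comment> \<open>\<open>\<rho>\<close> and the slope \<open>Y / X\<close> determine \<open>|X|\<close>, the sign of \<open>X\<close> being known\<close>
    have sq: "(?X u)\<^sup>2 * (1 + (?Y u / ?X u)\<^sup>2) = fst (axial (chart p u))" if "?X u \<noteq> 0" for u
      unfolding rot_norm[of ?t "chart p u", symmetric] using that
      by (simp add: power_divide distrib_left)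
    have "(?X v)\<^sup>2 * (1 + (?Y w / ?X w)\<^sup>2) = (?X w)\<^sup>2 * (1 + (?Y w / ?X w)\<^sup>2)"
      using sq[of v] sq[of w] X0 ratio axial by simp
    moreover have "1 + (?Y w / ?X w)\<^sup>2 \<noteq> 0"
      by (smt (verit) zero_le_power2)
    ultimately have "(?X v)\<^sup>2 = (?X w)\<^sup>2" by simp
    then have Xeq: "?X v = ?X w"
      using X0(3) by (auto simp: power2_eq_iff zero_less_mult_iff)
    then have Yeq: "?Y v = ?Y w" using ratio X0 by simp
    have "fst v $ 1 = fst w $ 1" "fst v $ 2 = fst w $ 2"
      using rot_recover[of "chart p v" ?t] rot_recover[of "chart p w" ?t] Xeq Yeq
      by (simp_all add: xyz_chart)
    moreover have "fst v $ 3 = fst w $ 3"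
      using axial by (simp add: axial_def xyz_chart)
    moreover have "snd v = snd w"
      using near[OF vw(1)] near[OF vw(2)] th by simp
    ultimately show "v = w"
      by (simp add: prod_eq_iff vec_eq_iff forall_3)
  qed
  obtain k where k: "homeomorphism B (K ` B) K k"
    using invariance_of_domain_homeomorphism[OF B(1) cont_K _ inj_K] by auto
  define N where "N = chart p ` B"
  have NW: "N \<subseteq> W" using near by (auto simp: N_def)
  have \<Phi>N: "\<Phi> ` N = K ` B" by (auto simp: N_def K_def)
  have open_image: "open (\<Phi> ` N)"
    unfolding \<Phi>N using invariance_of_domain_gen[OF B(1) cont_K inj_K] by auto
  \<comment> \<open>\<open>\<theta>\<^sub>1\<close> inverts the chart on \<open>N\<close>, which exhibits \<open>N\<close> as the preimage of an open set\<close>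
  have "N = W \<inter> (\<lambda>q. (fst q - fst p, \<theta> q $ 1 - \<theta> p $ 1)) -` B"
  proof (intro set_eqI iffI)
    fix q assume "q \<in> N"
    then obtain v where v: "v \<in> B" "q = chart p v" by (auto simp: N_def)
    then have "\<theta> q $ 1 - \<theta> p $ 1 = snd v" "fst q - fst p = fst v"
      using near[OF v(1)] by simp (simp add: v(2) chart_def)
    then have "(fst q - fst p, \<theta> q $ 1 - \<theta> p $ 1) = v"
      by simp
    then show "q \<in> W \<inter> (\<lambda>q. (fst q - fst p, \<theta> q $ 1 - \<theta> p $ 1)) -` B"
      using v near by auto
  next
    fix q assume q: "q \<in> W \<inter> (\<lambda>q. (fst q - fst p, \<theta> q $ 1 - \<theta> p $ 1)) -` B"
    have "snd q = snd p * cis (\<theta> q $ 1 - \<theta> p $ 1)"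
      using \<theta> p q by (simp add: angle_coordinates_def cis_mult)
    then have "q = chart p (fst q - fst p, \<theta> q $ 1 - \<theta> p $ 1)"
      by (simp add: chart_def prod_eq_iff)
    then show "q \<in> N" using q unfolding N_def by blast
  qed
  moreover have "continuous_on W (\<lambda>q. (fst q - fst p, \<theta> q $ 1 - \<theta> p $ 1))"
    using \<theta> by (intro continuous_intros) (simp add: angle_coordinates_def)
  ultimately have openN: "openin (top_of_set W) N"
    using B(1) by (simp add: continuous_openin_preimage_gen)
  have hom: "homeomorphism N (\<Phi> ` N) \<Phi> (chart p \<circ> k)"
    unfolding \<Phi>N
  proof (rule homeomorphismI)
    show "continuous_on N \<Phi>" using cont_\<Phi> NW by (rule continuous_on_subset)
    show "continuous_on (K ` B) (chart p \<circ> k)"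
      using homeomorphism_cont2[OF k] continuous_on_chart by (rule continuous_on_compose)
    show "\<Phi> ` N \<subseteq> K ` B" using \<Phi>N by simp
    show "(chart p \<circ> k) ` (K ` B) \<subseteq> N"
      using homeomorphism_apply1[OF k] by (auto simp: N_def)
    show "(chart p \<circ> k) (\<Phi> q) = q" if "q \<in> N" for q
      using that homeomorphism_apply1[OF k] by (auto simp: N_def K_def)
    show "\<Phi> ((chart p \<circ> k) y) = y" if "y \<in> K ` B" for y
      using homeomorphism_apply2[OF k that] by (simp add: K_def)
  qed
  have "(\<Phi> \<circ> chart q) differentiable (at 0) \<and> bij (differential \<Phi> q)" if "q \<in> N" for q
  proof -
    have q: "q \<in> W" using that NW by auto
    show ?thesis
      using deriv[OF q] differential_eq[OF deriv[OF q]] bij_coordinate_differential[OF n pos[OF q]]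
      by (auto simp: differentiable_def o_def)
  qed
  moreover have "p \<in> N"
    unfolding N_def using B(2) chart_0 by (metis image_eqI)
  ultimately show "\<exists>N. p \<in> N \<and> openin (top_of_set W) N \<and> open ((\<lambda>p. (\<theta> p, GH_mu n c p)) ` N) \<and>
      (\<exists>\<Psi>. homeomorphism N ((\<lambda>p. (\<theta> p, GH_mu n c p)) ` N) (\<lambda>p. (\<theta> p, GH_mu n c p)) \<Psi>) \<and>
      (\<forall>q\<in>N. ((\<lambda>p. (\<theta> p, GH_mu n c p)) \<circ> chart q) differentiable (at 0) \<and>
        bij (differential (\<lambda>p. (\<theta> p, GH_mu n c p)) q))"
    unfolding \<Phi>_def[symmetric] using openN open_image hom by blast
qed

section \<open>The symplectic form and the metric in the new coordinates\<close>

lemma GH_alpha_eq: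
  assumes "fst (axial p) > 0"
  shows "GH_alpha n c p v = - (fst (axial p) * axial_S n c (axial p) / 2) * theta_diff p v $ 2"
proof -
  have "GH_alpha n c p v = - 1 / 2 * ((xc p * fst v $ 2 - yc p * fst v $ 1) * axial_S n c (axial p))"
    unfolding GH_alpha_def axial_S_def differential_xyz rad_eq sum_distrib_left
    by (simp add: axial_def)
  then show ?thesis
    using assms by (simp add: theta_diff_def)
qed

text \<open>\<open>dx \<and> dy = (x dx + y dy) \<and> d\<theta>\<^sub>2\<close>; the \<open>dz\<close>-part of \<open>d\<mu>\<^sub>2 \<and> d\<theta>\<^sub>2\<close> is \<open>\<alpha> \<and> dz\<close>.\<close>

lemma GH_omega_eq:
  assumes "fst (axial p) > 0"
  shows "GH_omega n c p u v =
    ((\<lambda>w. mu_diff n c p w $ 1) \<^bold>\<and> (\<lambda>w. theta_diff p w $ 1)) u v +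
    ((\<lambda>w. mu_diff n c p w $ 2) \<^bold>\<and> (\<lambda>w. theta_diff p w $ 2)) u v"
proof -
  define s V S where "s = fst (axial p)" and "V = axial_V n c (axial p)" and "S = axial_S n c (axial p)"
  have s: "s > 0" "s = xc p * xc p + yc p * yc p"
    using assms by (simp_all add: s_def axial_def power2_eq_square)
  have area: "a * d - b * c =
      (x * a + y * c) * ((x * d - y * b) / s) - (x * b + y * d) * ((x * c - y * a) / s)"
    if "x = xc p" "y = yc p" for x y a b c d
    using s(1) by (simp add: divide_simps) (simp add: s(2) that algebra_simps)
  note area' = area[OF refl refl, where a = "fst u $ 1" and b = "fst v $ 1"
    and c = "fst u $ 2" and d = "fst v $ 2"]
  show ?thesis
    unfolding GH_omega_def Let_def wedge_prod_def GH_alpha_eq[OF assms] differential_xyz GH_V_eq area'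
    unfolding mu_diff_def theta_diff_def vector_2 dphi_def s_def[symmetric] V_def[symmetric] S_def[symmetric]
    using s(1) by (simp add: algebra_simps add_divide_distrib diff_divide_distrib)
qed

text \<open>The polar decomposition \<open>dx\<^sup>2 + dy\<^sup>2 = \<rho>\<^sup>2 d\<theta>\<^sub>2\<^sup>2 + (x dx + y dy)\<^sup>2 / \<rho>\<^sup>2\<close>, in which
  \<open>x dx + y dy\<close> is replaced by \<open>(d\<mu>\<^sub>2 + (s S/2) d\<mu>\<^sub>1) / V\<close>.\<close>

lemma horizontal_metric:
  fixes n :: nat and c :: "nat \<Rightarrow> real" and p :: point
  assumes "fst (axial p) > 0" "n \<ge> 1"
  defines "V \<equiv> axial_V n c (axial p)" and "s \<equiv> fst (axial p)" and "S \<equiv> axial_S n c (axial p)"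
  shows "fst u $ 1 * fst v $ 1 + fst u $ 2 * fst v $ 2 =
    s * (theta_diff p u $ 2 * theta_diff p v $ 2) +
    (mu_diff n c p u $ 2 + s * S / 2 * mu_diff n c p u $ 1) *
    (mu_diff n c p v $ 2 + s * S / 2 * mu_diff n c p v $ 1) / (V\<^sup>2 * s)"
proof -
  have pos: "V > 0" "s > 0" using axial_V_pos assms by auto
  have s: "s = xc p * xc p + yc p * yc p"
    by (simp add: s_def axial_def power2_eq_square)
  have R: "mu_diff n c p w $ 2 + s * S / 2 * mu_diff n c p w $ 1 = V * (xc p * fst w $ 1 + yc p * fst w $ 2)" for w
    by (simp add: mu_diff_def V_def s_def S_def)
  have "a1 * b1 + a2 * b2 = s * ((x * a2 - y * a1) / s * ((x * b2 - y * b1) / s)) +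
      V * (x * a1 + y * a2) * (V * (x * b1 + y * b2)) / (V\<^sup>2 * s)"
    if "x = xc p" "y = yc p" for x y a1 a2 b1 b2
  proof -
    have "V * (x * a1 + y * a2) * (V * (x * b1 + y * b2)) / (V\<^sup>2 * s) =
        (x * a1 + y * a2) * (x * b1 + y * b2) / s"
      using pos by (simp add: power2_eq_square)
    moreover have "(x * a2 - y * a1) * (x * b2 - y * b1) / s + (x * a1 + y * a2) * (x * b1 + y * b2) / s
        = a1 * b1 + a2 * b2"
      using pos by (simp add: divide_simps) (simp add: s that algebra_simps)
    ultimately show ?thesis
      using pos by simp
  qed
  from this[OF refl refl] show ?thesis
    unfolding R theta_diff_def vector_2 s_def[symmetric] .
qed

text \<open>With \<open>dx\<^sup>2 + dy\<^sup>2\<close> in the form above, \<open>g\<close> is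
  \<open>(d\<theta>\<^sub>1 - (s S/2) d\<theta>\<^sub>2)\<^sup>2 / V + V s d\<theta>\<^sub>2\<^sup>2 + (d\<mu>\<^sub>2 + (s S/2) d\<mu>\<^sub>1)\<^sup>2 / (V s) + V d\<mu>\<^sub>1\<^sup>2\<close>,
  and it remains to expand the two binomials.\<close>

lemma GH_metric_eq:
  fixes n :: nat and c :: "nat \<Rightarrow> real" and p :: point
  assumes "fst (axial p) > 0" "n \<ge> 1"
  defines "V \<equiv> axial_V n c (axial p)" and "s \<equiv> fst (axial p)" and "S \<equiv> axial_S n c (axial p)"
    and "t1 \<equiv> \<lambda>w. theta_diff p w $ 1" and "t2 \<equiv> \<lambda>w. theta_diff p w $ 2"
    and "m1 \<equiv> \<lambda>w. mu_diff n c p w $ 1" and "m2 \<equiv> \<lambda>w. mu_diff n c p w $ 2"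
  shows "GH_metric n c p u v =
    1 / V * (t1 \<odot> t1) u v - s * S / V * (t1 \<odot> t2) u v + (V * s + s\<^sup>2 * S\<^sup>2 / (4 * V)) * (t2 \<odot> t2) u v
    + (V + s * S\<^sup>2 / (4 * V)) * (m1 \<odot> m1) u v + S / V * (m1 \<odot> m2) u v + 1 / (V * s) * (m2 \<odot> m2) u v"
proof -
  have pos: "V > 0" "s > 0" using axial_V_pos assms by auto
  have t1: "dphi w = t1 w" and m1: "fst w $ 3 = - m1 w" for w
    by (simp_all add: t1_def theta_diff_def dphi_def m1_def mu_diff_def)
  have "GH_metric n c p u v =
    1 / V * ((t1 u - s * S / 2 * t2 u) * (t1 v - s * S / 2 * t2 v))
    + V * (fst u $ 1 * fst v $ 1 + fst u $ 2 * fst v $ 2 + m1 u * m1 v)"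
    unfolding GH_metric_def Let_def sym_prod_def GH_alpha_eq[OF assms(1)] differential_xyz GH_V_eq
      t1 m1 t2_def V_def s_def S_def
    using pos(1)[unfolded V_def] by (simp add: field_simps)
  also have "\<dots> = 1 / V * ((t1 u - s * S / 2 * t2 u) * (t1 v - s * S / 2 * t2 v))
    + V * (s * (t2 u * t2 v) + (m2 u + s * S / 2 * m1 u) * (m2 v + s * S / 2 * m1 v) / (V\<^sup>2 * s) + m1 u * m1 v)"
    unfolding horizontal_metric[OF assms(1,2), where c = c and u = u and v = v] V_def s_def S_def t2_def m1_def m2_def ..
  also have "\<dots> = 1 / V * (t1 \<odot> t1) u v - s * S / V * (t1 \<odot> t2) u v + (V * s + s\<^sup>2 * S\<^sup>2 / (4 * V)) * (t2 \<odot> t2) u v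
    + (V + s * S\<^sup>2 / (4 * V)) * (m1 \<odot> m1) u v + S / V * (m1 \<odot> m2) u v + 1 / (V * s) * (m2 \<odot> m2) u v"
  proof -
    have fibre: "1 / V * ((a - s * S / 2 * b) * (a' - s * S / 2 * b')) =
        1 / V * (a * a') - s * S / V * ((a * b' + a' * b) / 2) + s\<^sup>2 * S\<^sup>2 / (4 * V) * (b * b')"
      for a b a' b' :: real
      using pos by (simp add: field_simps power2_eq_square)
    have radial: "V * ((b + s * S / 2 * a) * (b' + s * S / 2 * a') / (V\<^sup>2 * s)) =
        s * S\<^sup>2 / (4 * V) * (a * a') + S / V * ((a * b' + a' * b) / 2) + 1 / (V * s) * (b * b')"
      for a b a' b' :: real
      using pos by (simp add: field_simps power2_eq_square)
    have diag: "(f \<odot> f) u v = f u * f v" for f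
      by (simp add: sym_prod_def)
    have mixed: "(f u * h v + f v * h u) / 2 = (f \<odot> h) u v" for f h
      by (simp add: sym_prod_def)
    show ?thesis
      unfolding fibre distrib_left[of V] radial diag unfolding mixed
      by (simp only: distrib_right mult.assoc add.commute add.left_commute add.assoc diff_conv_add_uminus)
  qed
  finally show ?thesis .
qed

section \<open>The metric as determined by the complex potential\<close>

text \<open>The entries of \<open>hessian_matrix\<close> are those found in \<open>has_derivative_partial_GH_psi\<close>; the
  determinant is \<open>4 / s\<close>.\<close>

definition hessian_matrix :: "nat \<Rightarrow> (nat \<Rightarrow> real) \<Rightarrow> real \<times> real \<Rightarrow> real ^ 2 ^ 2" where
  "hessian_matrix n c q = (let V = axial_V n c q; S = axial_S n c q; s = fst q in
     vector [vector [2 * V + s * S\<^sup>2 / (2 * V), S / V], vector [S / V, 2 / (V * s)]])"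

definition hessian_inverse :: "nat \<Rightarrow> (nat \<Rightarrow> real) \<Rightarrow> real \<times> real \<Rightarrow> real ^ 2 ^ 2" where
  "hessian_inverse n c q = (let V = axial_V n c q; S = axial_S n c q; s = fst q in
     vector [vector [1 / (2 * V), - (s * S / (4 * V))],
             vector [- (s * S / (4 * V)), V * s / 2 + s\<^sup>2 * S\<^sup>2 / (8 * V)]])"

lemma hessian_matrix_hessian_inverse:
  assumes "n \<ge> 1" "fst q > 0"
  shows "transpose (hessian_matrix n c q) = hessian_matrix n c q" "transpose (hessian_inverse n c q) = hessian_inverse n c q"
    "hessian_matrix n c q ** hessian_inverse n c q = mat 1" "hessian_inverse n c q ** hessian_matrix n c q = mat 1"
proof -
  have "axial_V n c q > 0" by (rule axial_V_pos[OF assms])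
  then show "transpose (hessian_matrix n c q) = hessian_matrix n c q" "transpose (hessian_inverse n c q) = hessian_inverse n c q"
    "hessian_matrix n c q ** hessian_inverse n c q = mat 1" "hessian_inverse n c q ** hessian_matrix n c q = mat 1"
    using assms(2)
    by (simp_all add: vec_eq_iff forall_2 transpose_def matrix_matrix_mult_def mat_def sum_2
        hessian_matrix_def hessian_inverse_def Let_def field_simps power2_eq_square)
qed

text \<open>Half of each entry of the Hessian and twice each entry of its inverse are the coefficients in
  \<open>GH_metric_eq\<close>; each mixed coefficient there is the sum of the two equal off-diagonal entries.\<close>

lemma complex_potential_GH_psi:
  assumes n: "n \<ge> 1" and W: "openin (top_of_set (GH_space c)) W" "W \<subseteq> {p. rho p > 0}"
    and \<theta>: "angle_coordinates W \<theta>"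
  shows "complex_potential W (GH_metric n c) \<theta> (GH_mu n c) (GH_psi n c)"
  unfolding complex_potential_def
proof (intro exI conjI ballI allI)
  let ?G = "\<lambda>m. hessian_matrix n c (axial_of_mu n c m)" and ?H = "\<lambda>m. hessian_inverse n c (axial_of_mu n c m)"
  have pos: "fst (axial q) > 0" if "q \<in> W" for q
    using W(2) that rho_pos_iff by auto
  fix m assume "m \<in> GH_mu n c ` W"
  then obtain p where p: "fst (axial p) > 0" "m = axial_mu n c (axial p)"
    using pos by (auto simp: GH_mu_eq)
  show "transpose (?G m) = ?G m" "transpose (?H m) = ?H m" "?G m ** ?H m = mat 1" "?H m ** ?G m = mat 1"
    unfolding p(2) axial_of_mu_axial_mu[OF n p(1)] by (rule hessian_matrix_hessian_inverse[OF n p(1)])+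
  show "GH_psi n c differentiable at m"
    unfolding p(2) using has_derivative_GH_psi[OF n p(1)] by (rule differentiableI)
  fix i j :: 2
  note D = has_derivative_partial_GH_psi[OF n p(1), of c]
  have j: "j = 1 \<or> j = 2" and i: "i = 1 \<or> i = 2" by (simp_all add: exhaust_2)
  show "partial j (GH_psi n c) differentiable at m"
    unfolding p(2) using j D by (auto intro: differentiableI)
  show "?G m $ i $ j = partial i (partial j (GH_psi n c)) m"
    unfolding p(2) axial_of_mu_axial_mu[OF n p(1)] using i j
    by (auto simp: D[THEN partial_eq] axis_2 hessian_matrix_def Let_def)
next
  fix p u v assume p: "p \<in> W"
  have pos: "fst (axial p) > 0"
    using W(2) p rho_pos_iff by auto
  have V: "axial_V n c (axial p) > 0" by (rule axial_V_pos[OF n pos])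
  show "GH_metric n c p u v = (\<Sum>i\<in>UNIV. \<Sum>j\<in>UNIV.
      1/2 * hessian_matrix n c (axial_of_mu n c (GH_mu n c p)) $ i $ j *
        (differential (\<lambda>q. GH_mu n c q $ i) p \<odot> differential (\<lambda>q. GH_mu n c q $ j) p) u v +
      2 * hessian_inverse n c (axial_of_mu n c (GH_mu n c p)) $ i $ j *
        (differential (\<lambda>q. \<theta> q $ i) p \<odot> differential (\<lambda>q. \<theta> q $ j) p) u v)"
  proof -
    define V S s where "V = axial_V n c (axial p)" and "S = axial_S n c (axial p)" and "s = fst (axial p)"
    have pos: "V > 0" "s > 0" using V pos by (simp_all add: V_def s_def)
    have coeffs:
      "1/2 * (2 * V + s * S\<^sup>2 / (2 * V)) = V + s * S\<^sup>2 / (4 * V)"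
      "1/2 * (2 / (V * s)) = 1 / (V * s)" "2 * (1 / (2 * V)) = 1 / V"
      "2 * - (s * S / (4 * V)) = - 1/2 * (s * S / V)"
      "2 * (V * s / 2 + s\<^sup>2 * S\<^sup>2 / (8 * V)) = V * s + s\<^sup>2 * S\<^sup>2 / (4 * V)"
      using pos by (simp_all add: field_simps)
    have sym: "(f \<odot> h) u v = (h \<odot> f) u v" for f h
      by (simp add: sym_prod_def add.commute)
    show ?thesis
      unfolding GH_metric_eq[OF \<open>fst (axial p) > 0\<close> n] differential_theta[OF W(1) \<theta> p \<open>fst (axial p) > 0\<close>]
        differential_GH_mu[OF \<open>fst (axial p) > 0\<close>]
      unfolding GH_mu_eq axial_of_mu_axial_mu[OF n \<open>fst (axial p) > 0\<close>] sum_2 hessian_matrix_def hessian_inverse_def Let_def vector_2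
      unfolding V_def[symmetric] S_def[symmetric] s_def[symmetric] coeffs
        sym[of "\<lambda>w. mu_diff n c p w $ 2" "\<lambda>w. mu_diff n c p w $ 1"]
        sym[of "\<lambda>w. theta_diff p w $ 2" "\<lambda>w. theta_diff p w $ 1"]
      by simp
  qed
qed

theorem proposition3p1:
  fixes n :: nat and c :: "nat \<Rightarrow> real"
  assumes "n \<ge> 1" and "strict_mono_on {1..n} c"
  shows
    "(\<forall>W \<theta>. openin (top_of_set (GH_space c)) W \<and> W \<subseteq> {p. rho p > 0} \<and> angle_coordinates W \<theta> \<longrightarrow>
       local_coordinates W (\<lambda>p. (\<theta> p, GH_mu n c p)) \<and>
       (\<forall>p\<in>W.
         let d\<theta>\<^sub>1 = differential (\<lambda>q. \<theta> q $ 1) p;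
             d\<theta>\<^sub>2 = differential (\<lambda>q. \<theta> q $ 2) p;
             d\<mu>\<^sub>1 = differential (\<lambda>q. GH_mu n c q $ 1) p;
             d\<mu>\<^sub>2 = differential (\<lambda>q. GH_mu n c q $ 2) p;
             V = GH_V n c p; \<rho> = rho p; z = zc p; r = (\<lambda>j. rad c j p)
         in \<forall>u v.
           GH_omega n c p u v = (d\<mu>\<^sub>1 \<^bold>\<and> d\<theta>\<^sub>1) u v + (d\<mu>\<^sub>2 \<^bold>\<and> d\<theta>\<^sub>2) u v \<and>
           GH_metric n c p u v =
             1 / V * (d\<theta>\<^sub>1 \<odot> d\<theta>\<^sub>1) u v
             - 1 / V * (\<Sum>j=1..n. \<rho>\<^sup>2 / (r j * (r j - (z - c j)))) * (d\<theta>\<^sub>1 \<odot> d\<theta>\<^sub>2) u v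
             + (V * \<rho>\<^sup>2 + 1 / (4 * V) * (\<Sum>j=1..n. \<rho>\<^sup>2 / (r j * (r j - (z - c j))))\<^sup>2)
                 * (d\<theta>\<^sub>2 \<odot> d\<theta>\<^sub>2) u v
             + (V + \<rho>\<^sup>2 / (4 * V) * (\<Sum>j=1..n. 1 / (r j * (r j - (z - c j))))\<^sup>2)
                 * (d\<mu>\<^sub>1 \<odot> d\<mu>\<^sub>1) u v
             + 1 / V * (\<Sum>j=1..n. 1 / (r j * (r j - (z - c j)))) * (d\<mu>\<^sub>1 \<odot> d\<mu>\<^sub>2) u v
             + 1 / (V * \<rho>\<^sup>2) * (d\<mu>\<^sub>2 \<odot> d\<mu>\<^sub>2) u v)) \<and>
     (\<exists>C\<^sub>1 C\<^sub>2. \<exists>\<psi> :: real ^ 2 \<Rightarrow> real.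
       (\<forall>W \<theta>. openin (top_of_set (GH_space c)) W \<and> W \<subseteq> {p. rho p > 0} \<and> angle_coordinates W \<theta> \<longrightarrow>
          complex_potential W (GH_metric n c) \<theta> (GH_mu n c) \<psi>) \<and>
       (\<forall>p\<in>GH_space c. rho p > 0 \<longrightarrow>
          \<psi> (GH_mu n c p) =
            1/2 * (\<Sum>j=1..n.
              (rad c j p + (zc p - c j)) * ln (rad c j p + (zc p - c j)) +
              (rad c j p - (zc p - c j)) * ln (rad c j p - (zc p - c j)))
            + C\<^sub>1 * GH_mu n c p $ 1 + C\<^sub>2 * GH_mu n c p $ 2 \<and>
          kaehler_potential \<psi> (GH_mu n c p) =
            - (\<Sum>j=1..n. c j * ln (rad c j p - (zc p - c j)))
            + C\<^sub>1 * GH_mu n c p $ 1 + C\<^sub>2 * GH_mu n c p $ 2))"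
proof (intro conjI allI impI ballI exI)
  fix W \<theta>
  assume A: "openin (top_of_set (GH_space c)) W \<and> W \<subseteq> {p. rho p > 0} \<and> angle_coordinates W \<theta>"
  then have W: "openin (top_of_set (GH_space c)) W" "W \<subseteq> {p. rho p > 0}"
    and \<theta>: "angle_coordinates W \<theta>" by auto
  show "local_coordinates W (\<lambda>p. (\<theta> p, GH_mu n c p))"
    by (rule local_coordinates_GH[OF assms(1) W \<theta>])
  show "complex_potential W (GH_metric n c) \<theta> (GH_mu n c) (GH_psi n c)"
    by (rule complex_potential_GH_psi[OF assms(1) W \<theta>])
  fix p assume p: "p \<in> W"
  have pos: "fst (axial p) > 0"
    using W(2) p rho_pos_iff by auto
  have S: "(\<Sum>j=1..n. 1 / (rad c j p * (rad c j p - (zc p - c j)))) = axial_S n c (axial p)"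
    by (simp add: axial_S_def rad_eq axial_def)
  have sS: "(\<Sum>j=1..n. fst (axial p) / (rad c j p * (rad c j p - (zc p - c j)))) = fst (axial p) * axial_S n c (axial p)"
    unfolding S[symmetric] sum_distrib_left by simp
  show "let d\<theta>\<^sub>1 = differential (\<lambda>q. \<theta> q $ 1) p;
             d\<theta>\<^sub>2 = differential (\<lambda>q. \<theta> q $ 2) p;
             d\<mu>\<^sub>1 = differential (\<lambda>q. GH_mu n c q $ 1) p;
             d\<mu>\<^sub>2 = differential (\<lambda>q. GH_mu n c q $ 2) p;
             V = GH_V n c p; \<rho> = rho p; z = zc p; r = (\<lambda>j. rad c j p)
         in \<forall>u v.
           GH_omega n c p u v = (d\<mu>\<^sub>1 \<^bold>\<and> d\<theta>\<^sub>1) u v + (d\<mu>\<^sub>2 \<^bold>\<and> d\<theta>\<^sub>2) u v \<and>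
           GH_metric n c p u v =
             1 / V * (d\<theta>\<^sub>1 \<odot> d\<theta>\<^sub>1) u v
             - 1 / V * (\<Sum>j=1..n. \<rho>\<^sup>2 / (r j * (r j - (z - c j)))) * (d\<theta>\<^sub>1 \<odot> d\<theta>\<^sub>2) u v
             + (V * \<rho>\<^sup>2 + 1 / (4 * V) * (\<Sum>j=1..n. \<rho>\<^sup>2 / (r j * (r j - (z - c j))))\<^sup>2)
                 * (d\<theta>\<^sub>2 \<odot> d\<theta>\<^sub>2) u v
             + (V + \<rho>\<^sup>2 / (4 * V) * (\<Sum>j=1..n. 1 / (r j * (r j - (z - c j))))\<^sup>2)
                 * (d\<mu>\<^sub>1 \<odot> d\<mu>\<^sub>1) u v
             + 1 / V * (\<Sum>j=1..n. 1 / (r j * (r j - (z - c j)))) * (d\<mu>\<^sub>1 \<odot> d\<mu>\<^sub>2) u v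
             + 1 / (V * \<rho>\<^sup>2) * (d\<mu>\<^sub>2 \<odot> d\<mu>\<^sub>2) u v"
    unfolding Let_def rho_power2 S sS GH_omega_eq[OF pos] GH_metric_eq[OF pos assms(1)]
      differential_theta[OF W(1) \<theta> p pos] differential_GH_mu[OF pos] GH_V_eq
    by (simp add: power_mult_distrib)
next
  fix p assume "rho p > 0"
  then have pos: "fst (axial p) > 0" by (simp add: rho_pos_iff)
  show "GH_psi n c (GH_mu n c p) =
      1/2 * (\<Sum>j=1..n.
        (rad c j p + (zc p - c j)) * ln (rad c j p + (zc p - c j)) +
        (rad c j p - (zc p - c j)) * ln (rad c j p - (zc p - c j)))
      + real n * GH_mu n c p $ 1 + 2 * GH_mu n c p $ 2"
    unfolding GH_psi_def GH_mu_eq axial_of_mu_axial_mu[OF assms(1) pos] axial_psi_def rad_eq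
    by (simp add: axial_def)
  show "kaehler_potential (GH_psi n c) (GH_mu n c p) =
      - (\<Sum>j=1..n. c j * ln (rad c j p - (zc p - c j)))
      + real n * GH_mu n c p $ 1 + 2 * GH_mu n c p $ 2"
    unfolding GH_mu_eq kaehler_potential_GH_psi[OF assms(1) pos] rad_eq
    by (simp add: axial_def)
qed

end
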